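(* Let $n\ge 1$ and let $R_0,\ldots,R_{n-1}$ be relations $R_j(z,x,y,c)$ on $z,x,y\in\mathbb{N}$ and colorings $c:[\mathbb{N}]^2\to\{0,1\}$, each computed by an oracle Turing machine which, with oracle $c$ and input $(z,x,y)$, halts for every oracle $c$ and every input. Then there is a computable coloring $c:[\mathbb{N}]^2\rightarrow\{0,1\}$ such that for every $j<n$, the set \[S_j=\{z\in\mathbb{N}\mid \forall x\,\exists y\, R_j(z,x,y,c)\}\] is not an infinite homogeneous set for $c$.
   Context: $[\mathbb{N}]^2$ denotes the set of unordered $2$-element subsets of $\mathbb{N}$. A set $H\subseteq\mathbb{N}$ is homogeneous for $c$ if $c$ is constant on $[H]^2$. *)

theory Defs
  imports Main "HOL-Library.Nat_Bijection"
begin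

text \<open>Oracle partial recursive functions (Kleene's mu-recursive functionals with one
  function oracle); these compute exactly the functionals computed by oracle Turing machines.\<close>

datatype recf =
    Z
  | S
  | Id nat
  | Cn recf "recf list"
  | Pr recf recf
  | Mn recf
  | Oracle

inductive eval :: "(nat \<Rightarrow> nat) \<Rightarrow> recf \<Rightarrow> nat list \<Rightarrow> nat \<Rightarrow> bool" for \<alpha> where
  eval_Z: "eval \<alpha> Z xs 0"
| eval_S: "eval \<alpha> S (x # xs) (Suc x)"
| eval_Id: "i < length xs \<Longrightarrow> eval \<alpha> (Id i) xs (xs ! i)"
| eval_Cn: "list_all2 (\<lambda>g y. eval \<alpha> g xs y) gs ys \<Longrightarrow> eval \<alpha> f ys z \<Longrightarrow> eval \<alpha> (Cn f gs) xs z"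
| eval_Pr0: "eval \<alpha> f xs z \<Longrightarrow> eval \<alpha> (Pr f g) (0 # xs) z"
| eval_PrS: "eval \<alpha> (Pr f g) (k # xs) y \<Longrightarrow> eval \<alpha> g (k # y # xs) z
              \<Longrightarrow> eval \<alpha> (Pr f g) (Suc k # xs) z"
| eval_Mn: "eval \<alpha> f (y # xs) 0 \<Longrightarrow> (\<forall>k<y. \<exists>v. v \<noteq> 0 \<and> eval \<alpha> f (k # xs) v)
              \<Longrightarrow> eval \<alpha> (Mn f) xs y"
| eval_Oracle: "eval \<alpha> Oracle (x # xs) (\<alpha> x)"

text \<open>A 2-coloring of [N]^2 is represented by c :: nat => nat => bool, where the colour of
  the pair {a,b} with a < b is c a b (True = 1, False = 0); values c a b with a >= b are
  irrelevant.\<close>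

type_synonym coloring = "nat \<Rightarrow> nat \<Rightarrow> bool"

definition color :: "coloring \<Rightarrow> nat \<Rightarrow> nat \<Rightarrow> nat" where
  "color c a b = (if c (min a b) (max a b) then 1 else 0)"

definition oracle_of :: "coloring \<Rightarrow> nat \<Rightarrow> nat" where
  "oracle_of c q = (case prod_decode q of (a, b) \<Rightarrow> if a = b then 0 else color c a b)"

definition total_oracle_computable ::
    "(nat \<Rightarrow> nat \<Rightarrow> nat \<Rightarrow> coloring \<Rightarrow> bool) \<Rightarrow> bool" where
  "total_oracle_computable R \<longleftrightarrow>
     (\<exists>M. (\<forall>c z x y. \<exists>v. eval (oracle_of c) M [z, x, y] v) \<and>
          (\<forall>c z x y. R z x y c \<longleftrightarrow> eval (oracle_of c) M [z, x, y] 1))"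

definition computable_coloring :: "coloring \<Rightarrow> bool" where
  "computable_coloring c \<longleftrightarrow>
     (\<exists>f. \<forall>a b. a < b \<longrightarrow> eval (\<lambda>_. 0) f [a, b] (color c a b))"

definition homogeneous :: "coloring \<Rightarrow> nat set \<Rightarrow> bool" where
  "homogeneous c H \<longleftrightarrow> (\<exists>k. \<forall>a\<in>H. \<forall>b\<in>H. a \<noteq> b \<longrightarrow> color c a b = k)"

end

theory Submission
  imports Defs "HOL-Library.Infinite_Set"
begin

text \<open>The colours of the pairs \<open>{a, s}\<close> with \<open>a < s\<close> are fixed at stage \<open>s\<close>. At that stage call \<open>z\<close>
  promising for \<open>j\<close> up to \<open>t\<close> if for every \<open>x < t\<close> some \<open>y < s\<close> is already known to satisfy
  \<open>R\<^sub>j(z, x, y, c)\<close>, by a computation that queries only pairs coloured before. Members of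
  \<open>S\<^sub>j\<close> become promising up to every \<open>t\<close> as \<open>s\<close> grows, nonmembers never do beyond a bound depending
  on \<open>z\<close>. The colours are chosen so that for all \<open>j < n\<close> and \<open>k, t \<le> s\<close>, the \<open>z < k\<close> that are
  promising for \<open>j\<close> up to \<open>t\<close> receive both colours as soon as there are at least \<open>2n\<close> of them.
  If \<open>S\<^sub>j\<close> is infinite, take \<open>k\<close> with \<open>|S\<^sub>j \<inter> [0, k)| \<ge> 2n\<close> and \<open>t\<close> beyond the bounds of the
  nonmembers below \<open>k\<close>: at every late stage \<open>s \<in> S\<^sub>j\<close> two members of \<open>S\<^sub>j\<close> below \<open>k\<close> get different
  colours with \<open>s\<close>, so \<open>S\<^sub>j\<close> is not homogeneous.

  Such a choice of colours exists by running \<open>k\<close> downwards from \<open>s\<close>: whenever the smallest level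
  set of size at least \<open>2n\<close> for \<open>j\<close> lacks a representative of some colour, an uncoloured element of
  it is made one. A representative stays in all later such sets until it is removed as \<open>k\<close> passes
  it, so at most \<open>2n - 1\<close> coloured elements remain when a new one is needed.\<close>

section \<open>Computable functions of an environment\<close>

text \<open>Functions take an environment \<open>e\<close> assigning values to variables; a term may be given any
  sufficiently long initial segment of it, so that no arities have to be tracked. Outside the domain
  \<open>D\<close> nothing is claimed, which accommodates partial functions.\<close>

definition computable_on :: "((nat \<Rightarrow> nat) \<Rightarrow> bool) \<Rightarrow> ((nat \<Rightarrow> nat) \<Rightarrow> nat) \<Rightarrow> bool" where
  "computable_on D F \<longleftrightarrow>
     (\<exists>K. \<forall>k\<ge>K. \<exists>f. \<forall>e. D e \<longrightarrow> eval (\<lambda>_. 0) f (map e [0..<k]) (F e))"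

lemma computable_onI:
  assumes "\<And>k. k \<ge> K \<Longrightarrow> \<exists>f. \<forall>e. D e \<longrightarrow> eval (\<lambda>_. 0) f (map e [0..<k]) (F e)"
  shows "computable_on D F"
  using assms unfolding computable_on_def by blast

lemma computable_on_cong:
  assumes "computable_on D' F" "\<And>e. D e \<Longrightarrow> D' e" "\<And>e. D e \<Longrightarrow> F e = G e"
  shows "computable_on D G"
  using assms unfolding computable_on_def by metis

lemma map_case_nat_upt: "map (case_nat x e) [0..<Suc k] = x # map e [0..<k]"
proof -
  have "[0..<Suc k] = 0 # map Suc [0..<k]"
    by (simp add: upt_conv_Cons map_Suc_upt del: upt_Suc)
  then show ?thesis by simp
qed

lemma computable_on_var: "computable_on D (\<lambda>e. e i)"
proof (rule computable_onI[of "Suc i"])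
  fix k assume "Suc i \<le> k"
  then have "eval (\<lambda>_. 0) (Id i) (map e [0..<k]) (e i)" for e
    using eval_Id[of i "map e [0..<k]"] by simp
  then show "\<exists>f. \<forall>e. D e \<longrightarrow> eval (\<lambda>_. 0) f (map e [0..<k]) (e i)" by blast
qed

lemma computable_on_zero: "computable_on D (\<lambda>e. 0)"
  by (rule computable_onI) (blast intro: eval_Z)

text \<open>A term for \<open>F\<close> reads only its first \<open>l\<close> variables, so only
  \<open>G 0\<close> to \<open>G (l - 1)\<close> have to be computed, and the sum of their finitely
  many thresholds bounds each of them.\<close>

lemma computable_on_subst:
  assumes F: "computable_on D' F" and G: "\<And>i. computable_on D (G i)"
    and D: "\<And>e. D e \<Longrightarrow> D' (\<lambda>i. G i e)"
  shows "computable_on D (\<lambda>e. F (\<lambda>i. G i e))"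
proof -
  obtain l f where f: "\<And>e. D' e \<Longrightarrow> eval (\<lambda>_. 0) f (map e [0..<l]) (F e)"
    using F unfolding computable_on_def by blast
  obtain K where K: "\<And>i k. k \<ge> K i \<Longrightarrow> \<exists>g. \<forall>e. D e \<longrightarrow> eval (\<lambda>_. 0) g (map e [0..<k]) (G i e)"
    using G unfolding computable_on_def by metis
  show ?thesis
  proof (rule computable_onI[of "\<Sum>i<l. K i"])
    fix k assume k: "k \<ge> (\<Sum>i<l. K i)"
    have "\<exists>g. \<forall>e. D e \<longrightarrow> eval (\<lambda>_. 0) g (map e [0..<k]) (G i e)" if "i < l" for i
    proof (rule K)
      have "K i \<le> (\<Sum>i<l. K i)" using that by (intro member_le_sum) auto
      with k show "K i \<le> k" by simp
    qed
    then obtain g where g: "\<And>i e. i < l \<Longrightarrow> D e \<Longrightarrow> eval (\<lambda>_. 0) (g i) (map e [0..<k]) (G i e)"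
      by metis
    have "eval (\<lambda>_. 0) (Cn f (map g [0..<l])) (map e [0..<k]) (F (\<lambda>i. G i e))" if "D e" for e
    proof (rule eval_Cn)
      show "list_all2 (\<lambda>h y. eval (\<lambda>_. 0) h (map e [0..<k]) y) (map g [0..<l]) (map (\<lambda>i. G i e) [0..<l])"
        using g that by (simp add: list_all2_conv_all_nth)
      show "eval (\<lambda>_. 0) f (map (\<lambda>i. G i e) [0..<l]) (F (\<lambda>i. G i e))"
        using f[OF D[OF that]] .
    qed
    then show "\<exists>f. \<forall>e. D e \<longrightarrow> eval (\<lambda>_. 0) f (map e [0..<k]) (F (\<lambda>i. G i e))" by blast
  qed
qed

lemma computable_on_Suc:
  assumes "computable_on D F" shows "computable_on D (\<lambda>e. Suc (F e))"
proof -
  have "computable_on (\<lambda>_. True) (\<lambda>e. Suc (e 0))"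
  proof (rule computable_onI[of 1])
    fix k :: nat assume "1 \<le> k"
    then obtain l where "k = Suc l" by (cases k) auto
    then have "eval (\<lambda>_. 0) S (map e [0..<k]) (Suc (e 0))" for e
      using eval_S[of _ "e 0"] by (simp add: upt_conv_Cons del: upt_Suc)
    then show "\<exists>f. \<forall>e. True \<longrightarrow> eval (\<lambda>_. 0) f (map e [0..<k]) (Suc (e 0))" by blast
  qed
  from computable_on_subst[OF this, of D "\<lambda>_. F"] assms show ?thesis by simp
qed

text \<open>Index and previous value are pushed in front of the environment, in the argument order
  of \<open>Pr\<close>. The domain \<open>D'\<close> has to contain only the environments that the
  recursion actually reaches.\<close>

lemma computable_on_rec:
  assumes F: "computable_on D F" and G: "computable_on D' G" and N: "computable_on D N"
    and D: "\<And>e m. D e \<Longrightarrow> m < N e \<Longrightarrow>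
      D' (case_nat m (case_nat (rec_nat (F e) (\<lambda>m y. G (case_nat m (case_nat y e))) m) e))"
  shows "computable_on D (\<lambda>e. rec_nat (F e) (\<lambda>m y. G (case_nat m (case_nat y e))) (N e))"
proof -
  obtain KF where KF: "\<And>k. k \<ge> KF \<Longrightarrow> \<exists>f. \<forall>e. D e \<longrightarrow> eval (\<lambda>_. 0) f (map e [0..<k]) (F e)"
    using F unfolding computable_on_def by blast
  obtain KG where KG: "\<And>k. k \<ge> KG \<Longrightarrow> \<exists>f. \<forall>e. D' e \<longrightarrow> eval (\<lambda>_. 0) f (map e [0..<k]) (G e)"
    using G unfolding computable_on_def by blast
  obtain KN where KN: "\<And>k. k \<ge> KN \<Longrightarrow> \<exists>f. \<forall>e. D e \<longrightarrow> eval (\<lambda>_. 0) f (map e [0..<k]) (N e)"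
    using N unfolding computable_on_def by blast
  show ?thesis
  proof (rule computable_onI[of "KF + KG + KN"])
    fix k assume "k \<ge> KF + KG + KN"
    then obtain f g h where
      f: "\<And>e. D e \<Longrightarrow> eval (\<lambda>_. 0) f (map e [0..<k]) (F e)" and
      g: "\<And>e. D' e \<Longrightarrow> eval (\<lambda>_. 0) g (map e [0..<Suc (Suc k)]) (G e)" and
      h: "\<And>e. D e \<Longrightarrow> eval (\<lambda>_. 0) h (map e [0..<k]) (N e)"
      using KF[of k] KG[of "Suc (Suc k)"] KN[of k] by (auto simp del: upt_Suc)
    have "eval (\<lambda>_. 0) (Cn (Pr f g) (h # map Id [0..<k])) (map e [0..<k])
            (rec_nat (F e) (\<lambda>m y. G (case_nat m (case_nat y e))) (N e))" if De: "D e" for e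
    proof (rule eval_Cn)
      let ?r = "rec_nat (F e) (\<lambda>m y. G (case_nat m (case_nat y e)))"
      show "list_all2 (\<lambda>h y. eval (\<lambda>_. 0) h (map e [0..<k]) y) (h # map Id [0..<k])
              (N e # map e [0..<k])"
        using h[OF De] eval_Id[of _ "map e [0..<k]"] by (auto simp: list_all2_conv_all_nth nth_Cons split: nat.split)
      have "m \<le> N e \<Longrightarrow> eval (\<lambda>_. 0) (Pr f g) (m # map e [0..<k]) (?r m)" for m
      proof (induction m)
        case 0
        show ?case using f[OF De] by (auto intro: eval_Pr0)
      next
        case (Suc m)
        have "D' (case_nat m (case_nat (?r m) e))" using D[OF De] Suc.prems by simp
        from g[OF this] have "eval (\<lambda>_. 0) g (m # ?r m # map e [0..<k]) (?r (Suc m))"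
          by (simp add: map_case_nat_upt del: upt_Suc)
        with Suc show ?case by (auto intro: eval_PrS)
      qed
      then show "eval (\<lambda>_. 0) (Pr f g) (N e # map e [0..<k]) (?r (N e))" by simp
    qed
    then show "\<exists>f. \<forall>e. D e \<longrightarrow> eval (\<lambda>_. 0) f (map e [0..<k])
        (rec_nat (F e) (\<lambda>m y. G (case_nat m (case_nat y e))) (N e))" by blast
  qed
qed

text \<open>\<open>Mn\<close> runs its body only up to the first zero, so nothing is required of
  \<open>F\<close> beyond some zero.\<close>

lemma computable_on_Least:
  assumes F: "computable_on D' F"
    and D: "\<And>e. D e \<Longrightarrow> \<exists>y. F (case_nat y e) = 0 \<and> (\<forall>m\<le>y. D' (case_nat m e))"
  shows "computable_on D (\<lambda>e. LEAST y. F (case_nat y e) = 0)"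
proof -
  obtain K where K: "\<And>k. k \<ge> K \<Longrightarrow> \<exists>f. \<forall>e. D' e \<longrightarrow> eval (\<lambda>_. 0) f (map e [0..<k]) (F e)"
    using F unfolding computable_on_def by blast
  show ?thesis
  proof (rule computable_onI[of K])
    fix k assume "k \<ge> K"
    then obtain f where
      f: "\<And>e. D' e \<Longrightarrow> eval (\<lambda>_. 0) f (map e [0..<Suc k]) (F e)"
      using K[of "Suc k"] by (auto simp del: upt_Suc)
    have "eval (\<lambda>_. 0) (Mn f) (map e [0..<k]) (LEAST y. F (case_nat y e) = 0)" if De: "D e" for e
    proof -
      let ?y = "LEAST y. F (case_nat y e) = 0"
      obtain y where y: "F (case_nat y e) = 0" "\<And>m. m \<le> y \<Longrightarrow> D' (case_nat m e)"
        using D[OF De] by blast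
      have le: "?y \<le> y" using y(1) by (rule Least_le)
      have f': "eval (\<lambda>_. 0) f (m # map e [0..<k]) (F (case_nat m e))" if "m \<le> ?y" for m
        using f[OF y(2), of m] that le by (simp add: map_case_nat_upt del: upt_Suc)
      have "F (case_nat ?y e) = 0" using y(1) by (rule LeastI)
      then have "eval (\<lambda>_. 0) f (?y # map e [0..<k]) 0" using f'[of ?y] by simp
      moreover have "\<forall>m<?y. \<exists>v. v \<noteq> 0 \<and> eval (\<lambda>_. 0) f (m # map e [0..<k]) v"
        using f' not_less_Least by (metis (mono_tags, lifting) less_imp_le)
      ultimately show ?thesis by (rule eval_Mn)
    qed
    then show "\<exists>f. \<forall>e. D e \<longrightarrow> eval (\<lambda>_. 0) f (map e [0..<k]) (LEAST y. F (case_nat y e) = 0)"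
      by blast
  qed
qed

section \<open>Total computable functions: arithmetic, sums and powers\<close>

abbreviation computable :: "((nat \<Rightarrow> nat) \<Rightarrow> nat) \<Rightarrow> bool" where
  "computable \<equiv> computable_on (\<lambda>_. True)"

lemma computable_on_unary:
  assumes "computable (\<lambda>e. f (e 0))" "computable_on D F"
  shows "computable_on D (\<lambda>e. f (F e))"
  using computable_on_subst[OF assms(1), of D "\<lambda>_. F"] assms(2) by simp

lemma computable_on_binary:
  assumes "computable (\<lambda>e. f (e 0) (e 1))" "computable_on D F" "computable_on D G"
  shows "computable_on D (\<lambda>e. f (F e) (G e))"
  using computable_on_subst[OF assms(1), of D "case_nat F (\<lambda>_. G)"] assms(2,3)
  by (simp split: nat.split)

lemma computable_rec:
  assumes "computable F" "computable (\<lambda>e. G (e 0) (e 1) (\<lambda>i. e (Suc (Suc i))))" "computable N"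
  shows "computable (\<lambda>e. rec_nat (F e) (\<lambda>m y. G m y e) (N e))"
  using computable_on_rec[OF assms] by simp

lemma computable_on_const: "computable_on D (\<lambda>e. c)"
  by (induction c) (auto intro: computable_on_zero computable_on_Suc)

lemma computable_on_add:
  assumes "computable_on D F" "computable_on D G"
  shows "computable_on D (\<lambda>e. F e + G e)"
proof (rule computable_on_binary[OF _ assms])
  have "rec_nat x (\<lambda>m r. Suc r) y = x + y" for x y :: nat by (induction y) auto
  moreover have "computable (\<lambda>e. rec_nat (e 0) (\<lambda>m r. Suc r) (e 1))"
    by (intro computable_rec computable_on_Suc computable_on_var)
  ultimately show "computable (\<lambda>e. e 0 + e 1)" by simp
qed

lemma computable_on_mult:
  assumes "computable_on D F" "computable_on D G"
  shows "computable_on D (\<lambda>e. F e * G e)"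
proof (rule computable_on_binary[OF _ assms])
  have "rec_nat 0 (\<lambda>m r. r + x) y = x * y" for x y :: nat by (induction y) auto
  moreover have "computable (\<lambda>e. rec_nat 0 (\<lambda>m r. r + e 0) (e 1))"
    by (intro computable_rec computable_on_add computable_on_zero computable_on_var)
  ultimately show "computable (\<lambda>e. e 0 * e 1)" by simp
qed

lemma computable_on_diff:
  assumes "computable_on D F" "computable_on D G"
  shows "computable_on D (\<lambda>e. F e - G e)"
proof (rule computable_on_binary[OF _ assms])
  have "rec_nat 0 (\<lambda>m r. m) x = x - 1" for x :: nat by (cases x) auto
  moreover have "computable (\<lambda>e. rec_nat 0 (\<lambda>m r. m) (e 0))"
    by (intro computable_rec computable_on_zero computable_on_var)
  ultimately have pred: "computable (\<lambda>e. e 0 - 1)" by simp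
  have "rec_nat x (\<lambda>m r. r - 1) y = x - y" for x y :: nat by (induction y) auto
  moreover have "computable (\<lambda>e. rec_nat (e 0) (\<lambda>m r. r - 1) (e 1))"
    by (intro computable_rec computable_on_unary[OF pred] computable_on_var)
  ultimately show "computable (\<lambda>e. e 0 - e 1)" by simp
qed

lemma computable_on_sum:
  assumes F: "computable_on D' F" and B: "computable_on D B"
    and D: "\<And>e z. D e \<Longrightarrow> z < B e \<Longrightarrow> D' (case_nat z e)"
  shows "computable_on D (\<lambda>e. \<Sum>z<B e. F (case_nat z e))"
proof -
  \<comment> \<open>Variable 1 holds the running total; the original environment starts at variable
    2, so the summand receives the index followed by that environment.\<close>
  let ?G = "\<lambda>e. e 1 + F (case_nat (e 0) (\<lambda>i. e (Suc (Suc i))))"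
  have G: "computable_on (\<lambda>e. D' (case_nat (e 0) (\<lambda>i. e (Suc (Suc i))))) ?G"
  proof (rule computable_on_add[OF computable_on_var])
    let ?H = "\<lambda>i e. case_nat (e 0 :: nat) (\<lambda>i. e (Suc (Suc i))) i"
    show "computable_on (\<lambda>e. D' (\<lambda>i. ?H i e)) (\<lambda>e. F (\<lambda>i. ?H i e))"
    proof (rule computable_on_subst[OF F, where G = ?H])
      show "computable_on (\<lambda>e. D' (\<lambda>i. ?H i e)) (?H i)" for i
        by (cases i) (auto intro: computable_on_var)
    qed
  qed
  have eq: "rec_nat 0 (\<lambda>m y. ?G (case_nat m (case_nat y e))) b = (\<Sum>z<b. F (case_nat z e))" for e b
    by (induction b) (auto simp: add.commute)
  show ?thesis
    using computable_on_rec[OF computable_on_zero G B] D unfolding eq by simp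
qed

lemma computable_sum:
  assumes "computable (\<lambda>e. F (e 0) (\<lambda>i. e (Suc i)))" "computable B"
  shows "computable (\<lambda>e. \<Sum>z<B e. F z e)"
  using computable_on_sum[OF assms] by simp

lemma computable_power2: "computable F \<Longrightarrow> computable (\<lambda>e. 2 ^ F e)"
proof (erule computable_on_unary[rotated])
  have "rec_nat 1 (\<lambda>m r. r * 2) y = (2::nat) ^ y" for y :: nat by (induction y) auto
  moreover have "computable (\<lambda>e. rec_nat 1 (\<lambda>m r. r * 2) (e 0))"
    by (intro computable_rec computable_on_mult computable_on_const computable_on_var)
  ultimately show "computable (\<lambda>e. 2 ^ e 0)" by simp
qed

section \<open>Decidable predicates: connectives, bounded quantifiers, counting and search\<close>

definition decidable :: "((nat \<Rightarrow> nat) \<Rightarrow> bool) \<Rightarrow> bool" where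
  "decidable P \<longleftrightarrow> computable (\<lambda>e. of_bool (P e))"

lemma decidable_not: "decidable P \<Longrightarrow> decidable (\<lambda>e. \<not> P e)"
  unfolding decidable_def
  by (rule computable_on_cong[OF computable_on_diff[OF computable_on_const[of _ 1]]]) auto

lemma decidable_and: "decidable P \<Longrightarrow> decidable Q \<Longrightarrow> decidable (\<lambda>e. P e \<and> Q e)"
  unfolding decidable_def of_bool_conj by (rule computable_on_mult)

lemma decidable_or: "decidable P \<Longrightarrow> decidable Q \<Longrightarrow> decidable (\<lambda>e. P e \<or> Q e)"
  using decidable_not[OF decidable_and[OF decidable_not decidable_not], of P Q] by simp

lemma decidable_imp: "decidable P \<Longrightarrow> decidable Q \<Longrightarrow> decidable (\<lambda>e. P e \<longrightarrow> Q e)"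
  using decidable_not[OF decidable_and[OF _ decidable_not], of P Q] by simp

lemma decidable_le:
  assumes "computable F" "computable G" shows "decidable (\<lambda>e. F e \<le> G e)"
proof -
  have "computable (\<lambda>e. 1 - (F e - G e))"
    by (intro computable_on_diff computable_on_const assms)
  then show ?thesis unfolding decidable_def
    by (rule computable_on_cong) auto
qed

lemma decidable_less:
  assumes "computable F" "computable G" shows "decidable (\<lambda>e. F e < G e)"
  using decidable_le[OF computable_on_Suc] assms by (simp add: Suc_le_eq)

lemma decidable_eq:
  assumes "computable F" "computable G" shows "decidable (\<lambda>e. F e = G e)"
  using decidable_and[OF decidable_le decidable_le, of F G G F] assms by (simp add: eq_iff)

lemma decidable_iff: "decidable P \<Longrightarrow> decidable Q \<Longrightarrow> decidable (\<lambda>e. P e \<longleftrightarrow> Q e)"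
  using decidable_and[OF decidable_imp decidable_imp, of P Q Q P] by (simp add: iff_conv_conj_imp)

lemma decidable_bex:
  assumes "computable B" "decidable (\<lambda>e. P (e 0) (\<lambda>i. e (Suc i)))"
  shows "decidable (\<lambda>e. \<exists>z<B e. P z e)"
proof -
  have "decidable (\<lambda>e. 0 < (\<Sum>z<B e. of_bool (P z e) :: nat))"
    using assms unfolding decidable_def[of "\<lambda>e. P (e 0) (\<lambda>i. e (Suc i))"]
    by (intro decidable_less computable_on_zero computable_sum)
  moreover have "0 < (\<Sum>z<B e. of_bool (P z e) :: nat) \<longleftrightarrow> (\<exists>z<B e. P z e)" for e
    by (auto simp: card_gt_0_iff)
  ultimately show ?thesis by simp
qed

lemma decidable_ball:
  assumes "computable B" "decidable (\<lambda>e. P (e 0) (\<lambda>i. e (Suc i)))"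
  shows "decidable (\<lambda>e. \<forall>z<B e. P z e)"
  using decidable_not[OF decidable_bex[OF assms(1), of "\<lambda>z e. \<not> P z e"]] decidable_not[OF assms(2)]
  by simp

lemma computable_card:
  assumes "computable B" "decidable (\<lambda>e. P (e 0) (\<lambda>i. e (Suc i)))"
  shows "computable (\<lambda>e. card {z. z < B e \<and> P z e})"
proof -
  have "card {z. z < b \<and> Q z} = (\<Sum>z<b. of_bool (Q z))" for b :: nat and Q
    by (simp add: sum_of_bool_eq Int_def)
  then show ?thesis
    using computable_sum[of "\<lambda>z e. of_bool (P z e)" B] assms unfolding decidable_def by simp
qed

lemma computable_Least:
  assumes "decidable (\<lambda>e. P (e 0) (\<lambda>i. e (Suc i)))" "\<And>e. \<exists>y. P y e"
  shows "computable (\<lambda>e. LEAST y. P y e)"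
proof -
  \<comment> \<open>Minimisation looks for a zero, so it is applied to the indicator of the
    negation.\<close>
  have "computable (\<lambda>e. of_bool (\<not> P (e 0) (\<lambda>i. e (Suc i))))"
    using decidable_not[OF assms(1)] unfolding decidable_def .
  from computable_on_Least[OF this] assms(2) show ?thesis by simp
qed

lemma computable_iterate:
  assumes "computable (\<lambda>e. G (e 0) (e 1))" "computable N"
  shows "computable (\<lambda>e. rec_nat a G (N e))"
  using computable_rec[OF computable_on_const[of _ a], of "\<lambda>m y e. G m y" N] assms by simp

section \<open>Evaluation with a bound on the oracle queries\<close>

text \<open>The last argument is a strict upper bound for the queries: a query of \<open>x\<close>
  costs \<open>Suc x\<close>. Uses of subcomputations are added, since a sum bounds every summand
  and is easy to compute.\<close>

inductive eval_use :: "(nat \<Rightarrow> nat) \<Rightarrow> recf \<Rightarrow> nat list \<Rightarrow> nat \<Rightarrow> nat \<Rightarrow> bool" for \<alpha> where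
  use_Z: "eval_use \<alpha> Z xs 0 0"
| use_S: "eval_use \<alpha> S (x # xs) (Suc x) 0"
| use_Id: "i < length xs \<Longrightarrow> eval_use \<alpha> (Id i) xs (xs ! i) 0"
| use_Cn: "(\<forall>i<length gs. eval_use \<alpha> (gs ! i) xs (ys i) (us i)) \<Longrightarrow>
    eval_use \<alpha> f (map ys [0..<length gs]) z u \<Longrightarrow>
    eval_use \<alpha> (Cn f gs) xs z (u + (\<Sum>i<length gs. us i))"
| use_Pr0: "eval_use \<alpha> f xs z u \<Longrightarrow> eval_use \<alpha> (Pr f g) (0 # xs) z u"
| use_PrS: "eval_use \<alpha> (Pr f g) (k # xs) y u \<Longrightarrow> eval_use \<alpha> g (k # y # xs) z w
    \<Longrightarrow> eval_use \<alpha> (Pr f g) (Suc k # xs) z (u + w)"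
| use_Mn: "eval_use \<alpha> f (y # xs) 0 (us y) \<Longrightarrow>
    (\<forall>k<y. \<exists>v. v \<noteq> 0 \<and> eval_use \<alpha> f (k # xs) v (us k)) \<Longrightarrow>
    eval_use \<alpha> (Mn f) xs y (\<Sum>k<Suc y. us k)"
| use_Oracle: "eval_use \<alpha> Oracle (x # xs) (\<alpha> x) (Suc x)"

lemma eval_imp_eval_use: "eval \<alpha> M xs v \<Longrightarrow> \<exists>u. eval_use \<alpha> M xs v u"
proof (induction rule: eval.induct)
  case (eval_Cn xs gs ys f z)
  have len: "length ys = length gs"
    using eval_Cn.IH(1) by (simp add: list_all2_lengthD)
  have "\<forall>i<length gs. \<exists>u. eval_use \<alpha> (gs ! i) xs (ys ! i) u"
    using eval_Cn.IH(1) by (simp add: list_all2_conv_all_nth)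
  then obtain us where us: "\<forall>i<length gs. eval_use \<alpha> (gs ! i) xs (ys ! i) (us i)" by metis
  have "map ((!) ys) [0..<length gs] = ys" using len map_nth by metis
  then show ?case using eval_Cn.IH(2) use_Cn[OF us] by auto
next
  case (eval_Mn f y xs)
  \<comment> \<open>The failing tests \<open>k < y\<close> and the successful one
    \<open>k = y\<close> are treated in one statement, because \<open>use_Mn\<close> needs a single
    function \<open>us\<close> for all of them.\<close>
  have "\<forall>k\<le>y. \<exists>u. \<exists>v. (k < y \<longrightarrow> v \<noteq> 0) \<and> (k = y \<longrightarrow> v = 0) \<and> eval_use \<alpha> f (k # xs) v u"
    using eval_Mn.IH by (metis le_neq_implies_less less_irrefl)
  then obtain us where
    us: "\<forall>k\<le>y. \<exists>v. (k < y \<longrightarrow> v \<noteq> 0) \<and> (k = y \<longrightarrow> v = 0) \<and> eval_use \<alpha> f (k # xs) v (us k)"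
    by metis
  have "eval_use \<alpha> f (y # xs) 0 (us y)" using us by auto
  moreover have "\<forall>k<y. \<exists>v. v \<noteq> 0 \<and> eval_use \<alpha> f (k # xs) v (us k)"
    using us less_imp_le by blast
  ultimately show ?case using use_Mn by blast
qed (blast intro: eval_use.intros)+

lemma eval_use_imp_eval: "eval_use \<alpha> M xs v u \<Longrightarrow> eval \<alpha> M xs v"
proof (induction rule: eval_use.induct)
  case (use_Cn gs xs ys us f z u)
  have "list_all2 (\<lambda>g y. eval \<alpha> g xs y) gs (map ys [0..<length gs])"
    using use_Cn.IH(1) by (simp add: list_all2_conv_all_nth)
  then show ?case using use_Cn.IH(2) by (rule eval_Cn)
next
  case (use_Mn f y xs us)
  then show ?case by (intro eval_Mn) blast+
qed (auto intro: eval.intros)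

text \<open>The use of each subcomputation is a summand of the total, so agreement of the oracles
  below the total passes down to it.\<close>

lemma eval_use_local:
  assumes "eval_use \<alpha> M xs v u" "\<And>q. q < u \<Longrightarrow> \<beta> q = \<alpha> q"
  shows "eval_use \<beta> M xs v u"
  using assms
proof (induction rule: eval_use.induct)
  case (use_Cn gs xs ys us f z u)
  have "eval_use \<beta> (gs ! i) xs (ys i) (us i)" if i: "i < length gs" for i
  proof -
    have "us i \<le> (\<Sum>i<length gs. us i)" using i by (intro member_le_sum) auto
    then show ?thesis using use_Cn.IH(1) use_Cn.prems i by force
  qed
  moreover have "eval_use \<beta> f (map ys [0..<length gs]) z u"
    using use_Cn.IH(2) use_Cn.prems by simp
  ultimately show ?case by (intro eval_use.use_Cn) auto
next
  case (use_Mn f y xs us)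
  have le: "us k \<le> (\<Sum>k<Suc y. us k)" if "k < Suc y" for k
    using that by (intro member_le_sum) auto
  have "eval_use \<beta> f (y # xs) 0 (us y)"
    using use_Mn.IH(1) use_Mn.prems le[of y] by force
  moreover have "\<exists>v. v \<noteq> 0 \<and> eval_use \<beta> f (k # xs) v (us k)" if "k < y" for k
  proof -
    have "us k \<le> (\<Sum>k<Suc y. us k)" using that le by simp
    then show ?thesis using use_Mn.IH(2) use_Mn.prems that by (meson order_less_le_trans)
  qed
  ultimately show ?case by (intro eval_use.use_Mn) auto
next
  case (use_Oracle x xs)
  then have "\<beta> x = \<alpha> x" by simp
  then show ?case using eval_use.use_Oracle[of \<beta> x xs] by simp
qed (auto intro: eval_use.intros)

section \<open>Simulation of oracle computations, uniformly in the oracle parameter\<close>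

inductive_cases use_ZE: "eval_use \<alpha> Z xs v u"
inductive_cases use_SE: "eval_use \<alpha> S xs v u"
inductive_cases use_IdE: "eval_use \<alpha> (Id i) xs v u"
inductive_cases use_OracleE: "eval_use \<alpha> Oracle xs v u"
inductive_cases use_CnE: "eval_use \<alpha> (Cn f gs) xs v u"
inductive_cases use_Pr_0E: "eval_use \<alpha> (Pr f g) (0 # xs) v u"
inductive_cases use_Pr_SucE: "eval_use \<alpha> (Pr f g) (Suc k # xs) v u"
inductive_cases use_Pr_NilE: "eval_use \<alpha> (Pr f g) [] v u"
inductive_cases use_MnE: "eval_use \<alpha> (Mn f) xs v u"

text \<open>The parameter \<open>p\<close> of the oracle \<open>\<omega> p\<close> is stored behind the \<open>a\<close> arguments, in variable \<open>a\<close>.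
  This way the recursion and minimisation variables can be pushed in front of it.\<close>

definition defined_at :: "(nat \<Rightarrow> nat \<Rightarrow> nat) \<Rightarrow> recf \<Rightarrow> nat \<Rightarrow> (nat \<Rightarrow> nat) \<Rightarrow> bool" where
  "defined_at \<omega> M a e \<longleftrightarrow> (\<exists>v u. eval_use (\<omega> (e a)) M (map e [0..<a]) v u)"

text \<open>Since every derivable value and use must be \<open>V e\<close> and \<open>U e\<close>,
  determinacy of \<open>eval_use\<close> is obtained by the same induction as computability.\<close>

definition simulated ::
  "(nat \<Rightarrow> nat \<Rightarrow> nat) \<Rightarrow> recf \<Rightarrow> nat \<Rightarrow> ((nat \<Rightarrow> nat) \<Rightarrow> nat) \<Rightarrow> ((nat \<Rightarrow> nat) \<Rightarrow> nat) \<Rightarrow> bool" where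
  "simulated \<omega> M a V U \<longleftrightarrow>
     computable_on (defined_at \<omega> M a) V \<and> computable_on (defined_at \<omega> M a) U \<and>
     (\<forall>e v u. eval_use (\<omega> (e a)) M (map e [0..<a]) v u \<longrightarrow> V e = v \<and> U e = u)"

lemma simulatedD:
  assumes "simulated \<omega> M a V U" "eval_use (\<omega> p) M xs v u" "p = e a" "xs = map e [0..<a]"
  shows "V e = v" "U e = u" "defined_at \<omega> M a e"
  using assms unfolding simulated_def defined_at_def by blast+

lemma computable_on_finite_sum:
  assumes "\<And>i. i < (n::nat) \<Longrightarrow> computable_on D (F i)"
  shows "computable_on D (\<lambda>e. \<Sum>i<n. F i e)"
  using assms by (induction n) (auto intro: computable_on_zero computable_on_add)

lemma computable_on_shift:
  assumes "computable_on D' F" "\<And>e. D e \<Longrightarrow> D' (\<lambda>i. e (Suc i))"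
  shows "computable_on D (\<lambda>e. F (\<lambda>i. e (Suc i)))"
  using computable_on_subst[OF assms(1), of D "\<lambda>i e. e (Suc i)"] assms(2) computable_on_var by simp

lemma computable_on_case_nat:
  assumes "computable_on D F" "\<And>i. computable_on D (G i)"
  shows "computable_on D (\<lambda>e. case i of 0 \<Rightarrow> F e | Suc i \<Rightarrow> G i e)"
  using assms by (cases i) auto

lemma simulated_Cn:
  assumes f: "simulated \<omega> f (length gs) Vf Uf"
    and g: "\<And>i. i < length gs \<Longrightarrow> simulated \<omega> (gs ! i) a (Vg i) (Ug i)"
  shows "\<exists>V U. simulated \<omega> (Cn f gs) a V U"
proof -
  let ?D = "defined_at \<omega> (Cn f gs) a"
  \<comment> \<open>The environment for \<open>f\<close> consists of the values of
    \<open>gs\<close>; the default \<open>e a\<close> puts the oracle parameter right behind them,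
    in variable \<open>length gs\<close>.\<close>
  define E where "E = (\<lambda>i e. if i < length gs then Vg i e else e a)"
  let ?V = "\<lambda>e. Vf (\<lambda>i. E i e)"
  let ?U = "\<lambda>e. Uf (\<lambda>i. E i e) + (\<Sum>i<length gs. Ug i e)"
  have *: "?V e = v \<and> ?U e = u \<and> (\<forall>i<length gs. defined_at \<omega> (gs ! i) a e) \<and>
      defined_at \<omega> f (length gs) (\<lambda>i. E i e)"
    if "eval_use (\<omega> (e a)) (Cn f gs) (map e [0..<a]) v u" for e v u
    using that
  proof (rule use_CnE)
    fix ys us w
    assume u: "u = w + sum us {..<length gs}"
      and g': "\<forall>i<length gs. eval_use (\<omega> (e a)) (gs ! i) (map e [0..<a]) (ys i) (us i)"
      and f': "eval_use (\<omega> (e a)) f (map ys [0..<length gs]) v w"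
    have g'': "Vg i e = ys i" "Ug i e = us i" "defined_at \<omega> (gs ! i) a e" if "i < length gs" for i
      using simulatedD[OF g[OF that] g'[rule_format, OF that]] by auto
    have "map ys [0..<length gs] = map (\<lambda>i. E i e) [0..<length gs]" "e a = E (length gs) e"
      using g''(1) by (auto simp: E_def)
    from simulatedD[OF f f' this(2,1)] g'' u show ?thesis by simp
  qed
  have D: "?D e \<Longrightarrow> i < length gs \<Longrightarrow> defined_at \<omega> (gs ! i) a e"
    "?D e \<Longrightarrow> defined_at \<omega> f (length gs) (\<lambda>i. E i e)" for e i
    using * unfolding defined_at_def[of \<omega> "Cn f gs"] by blast+
  have Vg: "computable_on ?D (Vg i)" and Ug: "computable_on ?D (Ug i)" if "i < length gs" for i
    using g[OF that] D(1)[OF _ that] unfolding simulated_def by (blast intro: computable_on_cong)+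
  have E: "computable_on ?D (E i)" for i
    using Vg[of i] computable_on_var unfolding E_def by (cases "i < length gs") auto
  have "computable_on ?D ?V" "computable_on ?D ?U"
    using f D(2) unfolding simulated_def
    by (auto intro!: computable_on_add computable_on_finite_sum Ug
        computable_on_subst[where G = E and D' = "defined_at \<omega> f (length gs)"] E)
  with * show ?thesis unfolding simulated_def by blast
qed

lemma map_upt_Suc_shift: "map e [0..<Suc b] = e 0 # map (\<lambda>i. e (Suc i)) [0..<b]"
proof -
  have "[0..<Suc b] = 0 # map Suc [0..<b]"
    by (simp add: upt_conv_Cons map_Suc_upt del: upt_Suc)
  then show ?thesis by simp
qed

text \<open>A run up to \<open>n\<close> contains the runs up to all smaller arguments. In
  \<open>simulated_Pr\<close> this keeps the earlier steps of a convergent recursion inside the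
  domain.\<close>

lemma eval_use_Pr_le:
  assumes "eval_use \<alpha> (Pr f g) (n # xs) v u" "m \<le> n"
  shows "\<exists>v u. eval_use \<alpha> (Pr f g) (m # xs) v u"
  using assms
proof (induction n arbitrary: v u)
  case (Suc n)
  show ?case
  proof (cases "m = Suc n")
    case True
    then show ?thesis using Suc.prems(1) by blast
  next
    case False
    then have "m \<le> n" using Suc.prems(2) by simp
    with Suc.prems(1) Suc.IH show ?thesis by (blast elim: use_Pr_SucE)
  qed
qed auto

text \<open>The value and the use are computed by two recursions. The running value of
  \<open>U'\<close> is the accumulated use, so the value needed at each step is recomputed from
  \<open>V'\<close>.\<close>

lemma simulated_Pr:
  assumes f: "simulated \<omega> f b Vf Uf" and g: "simulated \<omega> g (Suc (Suc b)) Vg Ug"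
  shows "\<exists>V U. simulated \<omega> (Pr f g) (Suc b) V U"
proof -
  let ?D = "defined_at \<omega> (Pr f g) (Suc b)"
  let ?s = "\<lambda>e i. e (Suc i) :: nat"
  let ?Dg = "defined_at \<omega> g (Suc (Suc b))"
  define V' where "V' e = rec_nat (Vf e) (\<lambda>m y. Vg (case_nat m (case_nat y e)))" for e
  define U' where "U' e = rec_nat (Uf e) (\<lambda>m y. y + Ug (case_nat m (case_nat (V' e m) e)))" for e
  define V where "V e = V' (?s e) (e 0)" for e
  define U where "U e = U' (?s e) (e 0)" for e
  have V'_simps: "V' e 0 = Vf e" "V' e (Suc m) = Vg (case_nat m (case_nat (V' e m) e))"
    and U'_simps: "U' e 0 = Uf e" "U' e (Suc m) = U' e m + Ug (case_nat m (case_nat (V' e m) e))" for e m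
    by (simp_all add: V'_def U'_def)
  have *: "V' e m = v \<and> U' e m = u \<and> defined_at \<omega> f b e \<and>
      (\<forall>l<m. ?Dg (case_nat l (case_nat (V' e l) e)))"
    if "eval_use (\<omega> (e b)) (Pr f g) (m # map e [0..<b]) v u" for e m v u
    using that
  proof (induction m arbitrary: v u)
    case 0
    then have "eval_use (\<omega> (e b)) f (map e [0..<b]) v u" by (auto elim: use_Pr_0E)
    from simulatedD[OF f this refl refl] show ?case by (simp add: V'_simps U'_simps)
  next
    case (Suc m)
    from Suc.prems show ?case
    proof (rule use_Pr_SucE)
      fix y u1 u2
      assume u: "u = u1 + u2" and p: "eval_use (\<omega> (e b)) (Pr f g) (m # map e [0..<b]) y u1"
        and g': "eval_use (\<omega> (e b)) g (m # y # map e [0..<b]) v u2"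
      have IH: "V' e m = y" "U' e m = u1" "defined_at \<omega> f b e"
        "\<And>l. l < m \<Longrightarrow> ?Dg (case_nat l (case_nat (V' e l) e))"
        using Suc.IH[OF p] by blast+
      let ?e = "case_nat m (case_nat (V' e m) e)"
      have "e b = ?e (Suc (Suc b))" "m # y # map e [0..<b] = map ?e [0..<Suc (Suc b)]"
        by (simp_all add: map_case_nat_upt IH(1) del: upt_Suc)
      note g'' = simulatedD[OF g g' this]
      have "?Dg (case_nat l (case_nat (V' e l) e))" if "l < Suc m" for l
        using IH(4) g''(3) that unfolding less_Suc_eq by blast
      moreover have "V' e (Suc m) = v" "U' e (Suc m) = u"
        using g''(1,2) IH(2) u unfolding V'_simps U'_simps by blast+
      ultimately show ?thesis using IH(3) by blast
    qed
  qed
  have D_iff: "?D e \<longleftrightarrow> (\<exists>v u. eval_use (\<omega> (e (Suc b))) (Pr f g) (e 0 # map (?s e) [0..<b]) v u)" for e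
    unfolding defined_at_def map_upt_Suc_shift ..
  have Df: "defined_at \<omega> f b (?s e)"
    and Dg: "m < e 0 \<Longrightarrow> ?Dg (case_nat m (case_nat (V' (?s e) m) (?s e)))"
    and DP: "m < e 0 \<Longrightarrow> ?D (case_nat m (?s e))"
    if De: "?D e" for e m
  proof -
    obtain v u where vu: "eval_use (\<omega> (e (Suc b))) (Pr f g) (e 0 # map (?s e) [0..<b]) v u"
      using De unfolding D_iff by blast
    then show "defined_at \<omega> f b (?s e)"
      and "m < e 0 \<Longrightarrow> ?Dg (case_nat m (case_nat (V' (?s e) m) (?s e)))"
      using *[of "?s e" "e 0"] by blast+
    show "?D (case_nat m (?s e))" if "m < e 0"
      using eval_use_Pr_le[OF vu, of m] that unfolding D_iff by simp
  qed
  have Vf: "computable_on ?D (\<lambda>e. Vf (?s e))" and Uf: "computable_on ?D (\<lambda>e. Uf (?s e))"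
    using f Df unfolding simulated_def by (blast intro: computable_on_shift)+
  \<comment> \<open>\<open>V'\<close> runs on the environment without its head, the recursion
    argument. \<open>T\<close> deletes that argument, which sits at position 2 behind the index and
    the previous value.\<close>
  define T where "T i e = (case i of 0 \<Rightarrow> e 0 | Suc i \<Rightarrow> (case i of 0 \<Rightarrow> e (Suc 0) | Suc i \<Rightarrow> e (Suc (Suc (Suc i)))))"
    for i :: nat and e :: "nat \<Rightarrow> nat"
  have T_eq: "(\<lambda>i. T i (case_nat m (case_nat y e))) = case_nat m (case_nat y (?s e))" for m y e
    by (auto simp: T_def split: nat.split)
  have "computable_on D (T i)" for D i
    unfolding T_def by (intro computable_on_case_nat computable_on_var)
  then have T: "computable_on (\<lambda>e. ?Dg (\<lambda>i. T i e)) (\<lambda>e. Vg (\<lambda>i. T i e))"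
    using g unfolding simulated_def by (blast intro: computable_on_subst)
  have V: "computable_on ?D V"
    using computable_on_rec[OF Vf T computable_on_var[of _ 0]] Dg
    unfolding T_eq V_def[abs_def] V'_def by blast
  \<comment> \<open>\<open>Q\<close> deletes position 1, the accumulated use, as well, so that
    \<open>V\<close> is called with recursion argument \<open>m\<close>; \<open>T'\<close> puts the
    resulting value where the accumulated use stood.\<close>
  define Q where "Q i e = (case i of 0 \<Rightarrow> e 0 | Suc i \<Rightarrow> e (Suc (Suc (Suc i))))"
    for i :: nat and e :: "nat \<Rightarrow> nat"
  define T' where "T' i e = (case i of 0 \<Rightarrow> e 0 | Suc i \<Rightarrow> (case i of 0 \<Rightarrow> V (\<lambda>i. Q i e) | Suc i \<Rightarrow> e (Suc (Suc (Suc i)))))"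
    for i :: nat and e :: "nat \<Rightarrow> nat"
  have Q_eq: "(\<lambda>i. Q i (case_nat m (case_nat y e))) = case_nat m (?s e)" for m y e
    by (auto simp: Q_def split: nat.split)
  have T'_eq: "(\<lambda>i. T' i (case_nat m (case_nat y e))) = case_nat m (case_nat (V' (?s e) m) (?s e))" for m y e
    by (auto simp: T'_def Q_eq V_def split: nat.split)
  let ?D' = "\<lambda>e. ?D (\<lambda>i. Q i e) \<and> ?Dg (\<lambda>i. T' i e)"
  have Q: "computable_on D (Q i)" for D i
    unfolding Q_def by (intro computable_on_case_nat computable_on_var)
  have "computable_on ?D' (\<lambda>e. V (\<lambda>i. Q i e))"
    by (rule computable_on_subst[OF V Q]) blast
  then have T'_comp: "computable_on ?D' (T' i)" for i
    unfolding T'_def by (intro computable_on_case_nat computable_on_var)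
  have "computable_on ?D' (\<lambda>e. Ug (\<lambda>i. T' i e))"
    using g T'_comp unfolding simulated_def by (blast intro: computable_on_subst)
  then have T': "computable_on ?D' (\<lambda>e. e (Suc 0) + Ug (\<lambda>i. T' i e))"
    by (intro computable_on_add computable_on_var)
  have "computable_on ?D (\<lambda>e. rec_nat (Uf (?s e))
      (\<lambda>m y. case_nat m (case_nat y e) (Suc 0) + Ug (\<lambda>i. T' i (case_nat m (case_nat y e)))) (e 0))"
    by (rule computable_on_rec[OF Uf T' computable_on_var]) (simp only: T'_eq Q_eq Dg DP)
  then have U: "computable_on ?D U"
    unfolding T'_eq U_def[abs_def] U'_def by simp
  have "V e = v \<and> U e = u" if "eval_use (\<omega> (e (Suc b))) (Pr f g) (map e [0..<Suc b]) v u" for e v u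
    using *[of "?s e" "e 0"] that unfolding map_upt_Suc_shift V_def U_def by blast
  with V U show ?thesis unfolding simulated_def by blast
qed

lemma simulated_Mn:
  assumes f: "simulated \<omega> f (Suc a) Vf Uf"
  shows "\<exists>V U. simulated \<omega> (Mn f) a V U"
proof -
  let ?D = "defined_at \<omega> (Mn f) a"
  let ?Df = "defined_at \<omega> f (Suc a)"
  define V where "V e = (LEAST y. Vf (case_nat y e) = 0)" for e
  \<comment> \<open>The successful test at \<open>V e\<close> may query the oracle too, hence the
    bound \<open>Suc (V e)\<close>.\<close>
  define U where "U e = (\<Sum>k<Suc (V e). Uf (case_nat k e))" for e
  have *: "V e = v \<and> U e = u \<and> Vf (case_nat v e) = 0 \<and> (\<forall>k<Suc v. ?Df (case_nat k e))"
    if "eval_use (\<omega> (e a)) (Mn f) (map e [0..<a]) v u" for e v u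
    using that
  proof (rule use_MnE)
    fix us
    assume u: "u = sum us {..<v} + us v" and v: "eval_use (\<omega> (e a)) f (v # map e [0..<a]) 0 (us v)"
      and less: "\<forall>k<v. \<exists>w>0. eval_use (\<omega> (e a)) f (k # map e [0..<a]) w (us k)"
    have f': "Vf (case_nat k e) = w" "Uf (case_nat k e) = us k" "?Df (case_nat k e)"
      if "eval_use (\<omega> (e a)) f (k # map e [0..<a]) w (us k)" for k w
      by (rule simulatedD[OF f that]; simp add: map_case_nat_upt del: upt_Suc)+
    note v' = f'[OF v]
    have less': "Vf (case_nat k e) \<noteq> 0" "Uf (case_nat k e) = us k" "?Df (case_nat k e)" if "k < v" for k
      using f'[of k] less that by blast+
    have "V e = v" unfolding V_def
      using v'(1) less'(1) by (intro Least_equality) (use not_less in blast)+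
    moreover have "Uf (case_nat k e) = us k" if "k < Suc v" for k
      using v'(2) less'(2) that by (cases "k = v") auto
    then have "(\<Sum>k<Suc v. Uf (case_nat k e)) = sum us {..<v} + us v" by simp
    moreover have "?Df (case_nat k e)" if "k < Suc v" for k
      using v'(3) less' that unfolding less_Suc_eq by blast
    ultimately show ?thesis using v'(1) u unfolding U_def by blast
  qed
  have V: "computable_on ?D V"
    unfolding V_def
  proof (rule computable_on_Least)
    show "computable_on ?Df Vf" using f unfolding simulated_def by blast
    show "\<exists>y. Vf (case_nat y e) = 0 \<and> (\<forall>k\<le>y. ?Df (case_nat k e))" if "?D e" for e
      using that * unfolding defined_at_def[of \<omega> "Mn f"] less_Suc_eq_le by blast
  qed
  have U: "computable_on ?D U"
    unfolding U_def
  proof (rule computable_on_sum)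
    show "computable_on ?Df Uf" using f unfolding simulated_def by blast
    show "computable_on ?D (\<lambda>e. Suc (V e))" using V by (rule computable_on_Suc)
    show "?Df (case_nat k e)" if "?D e" "k < Suc (V e)" for e k
      using that * unfolding defined_at_def[of \<omega> "Mn f"] by blast
  qed
  from * V U show ?thesis unfolding simulated_def by blast
qed

text \<open>The arity \<open>a\<close> is generalised because composition, recursion and
  minimisation evaluate subterms at other arities.\<close>

lemma ex_simulated:
  assumes \<omega>: "computable (\<lambda>e. \<omega> (e 0) (e 1))"
  shows "\<exists>V U. simulated \<omega> M a V U"
proof (induction M arbitrary: a)
  case Z
  have "simulated \<omega> Z a (\<lambda>_. 0) (\<lambda>_. 0)"
    unfolding simulated_def by (auto intro: computable_on_zero elim: use_ZE)
  then show ?case by blast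
next
  case S
  have "e 0 = x" if "x # xs = map e [0..<a]" for e :: "nat \<Rightarrow> nat" and x xs
    using that by (cases a) (auto simp: map_upt_Suc_shift simp del: upt_Suc)
  then have "simulated \<omega> S a (\<lambda>e. Suc (e 0)) (\<lambda>_. 0)"
    unfolding simulated_def
    by (auto intro!: computable_on_zero computable_on_Suc computable_on_var elim!: use_SE)
  then show ?case by blast
next
  case (Id i)
  have "simulated \<omega> (Id i) a (\<lambda>e. e i) (\<lambda>_. 0)"
    unfolding simulated_def
    by (auto intro: computable_on_zero computable_on_var elim!: use_IdE)
  then show ?case by blast
next
  case Oracle
  have "\<omega> (e a) (e 0) = v \<and> Suc (e 0) = u"
    if "eval_use (\<omega> (e a)) Oracle (map e [0..<a]) v u" for e v u
    using that
  proof (rule use_OracleE)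
    fix x xs assume *: "map e [0..<a] = x # xs" "v = \<omega> (e a) x" "u = Suc x"
    then have "e 0 = x" by (cases a) (auto simp: map_upt_Suc_shift simp del: upt_Suc)
    with * show ?thesis by simp
  qed
  then have "simulated \<omega> Oracle a (\<lambda>e. \<omega> (e a) (e 0)) (\<lambda>e. Suc (e 0))"
    unfolding simulated_def
    by (auto intro!: computable_on_binary[OF \<omega>] computable_on_Suc computable_on_var)
  then show ?case by blast
next
  case (Cn f gs)
  obtain Vf Uf where "simulated \<omega> f (length gs) Vf Uf" using Cn.IH(1) by blast
  moreover have "\<forall>i<length gs. \<exists>V U. simulated \<omega> (gs ! i) a V U" using Cn.IH(2) by simp
  then obtain Vg Ug where "\<And>i. i < length gs \<Longrightarrow> simulated \<omega> (gs ! i) a (Vg i) (Ug i)" by metis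
  ultimately show ?case by (rule simulated_Cn)
next
  case (Pr f g)
  show ?case
  proof (cases a)
    case 0
    \<comment> \<open>\<open>Pr\<close> never converges on the empty argument list, so the domain is
      empty and any functions serve.\<close>
    then have "simulated \<omega> (Pr f g) a (\<lambda>_. 0) (\<lambda>_. 0)"
      unfolding simulated_def by (auto intro: computable_on_zero elim: use_Pr_NilE)
    then show ?thesis by blast
  next
    case (Suc b)
    then show ?thesis using Pr.IH simulated_Pr by metis
  qed
next
  case (Mn f)
  then show ?case using simulated_Mn by metis
qed

section \<open>Colouring level sets\<close>

text \<open>Counting: while \<open>i\<close> is unassigned, \<open>r\<close> takes fewer than
  \<open>card I\<close> values, too few to exhaust \<open>W\<close>.\<close>

lemma ex_fresh_in:
  fixes r :: "'i \<rightharpoonup> 'a"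
  assumes "finite I" "dom r \<subseteq> I" "i \<in> I" "i \<notin> dom r" "card I \<le> card W"
  shows "\<exists>x\<in>W. x \<notin> ran r"
proof -
  have "finite (dom r)" using assms(1,2) finite_subset by blast
  moreover have "ran r = (\<lambda>i. the (r i)) ` dom r"
    by (force simp: ran_def image_iff)
  ultimately have "finite (ran r)" "card (ran r) \<le> card (dom r)"
    by (auto intro: card_image_le)
  moreover have "card (dom r) < card I" using assms by (intro psubset_card_mono) auto
  ultimately have "\<not> W \<subseteq> ran r" using assms(5) card_mono[of "ran r" W] by linarith
  then show ?thesis by blast
qed

lemma extend_representatives:
  fixes r :: "'i \<rightharpoonup> 'a"
  assumes I: "finite I" and J: "J \<subseteq> I"
    and W: "\<And>i. i \<in> J \<Longrightarrow> card I \<le> card (W i)"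
    and r: "dom r \<subseteq> I" "inj_on r (dom r)"
  shows "\<exists>r'. r \<subseteq>\<^sub>m r' \<and> dom r' = dom r \<union> J \<and> inj_on r' (dom r') \<and> (\<forall>i\<in>J - dom r. the (r' i) \<in> W i)"
proof -
  have "finite J" using I J finite_subset by blast
  then show ?thesis using J W
  proof (induction J)
    case empty
    show ?case using r by (intro exI[of _ r]) auto
  next
    case (insert i J)
    then obtain r' where r': "r \<subseteq>\<^sub>m r'" "dom r' = dom r \<union> J" "inj_on r' (dom r')"
      "\<forall>i\<in>J - dom r. the (r' i) \<in> W i"
      by auto
    show ?case
    proof (cases "i \<in> dom r'")
      case True
      then have "i \<in> dom r" using r'(2) insert.hyps by blast
      then show ?thesis using r' by (intro exI[of _ r']) auto
    next
      case False
      then obtain x where x: "x \<in> W i" "x \<notin> ran r'"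
        using ex_fresh_in[OF I, of r' i "W i"] r(1) r'(2) insert.prems by auto
      have "inj_on (r'(i \<mapsto> x)) (dom (r'(i \<mapsto> x)))"
        using r'(3) x(2) False by (auto simp: inj_on_def ran_def domIff)
      moreover have "r \<subseteq>\<^sub>m r'(i \<mapsto> x)"
        using r'(1,2) False by (auto simp: map_le_def)
      moreover have "\<forall>l\<in>insert i J - dom r. the ((r'(i \<mapsto> x)) l) \<in> W l"
        using r'(4) x(1) by auto
      moreover have "dom (r'(i \<mapsto> x)) = dom r \<union> insert i J" using r'(2) by simp
      ultimately show ?thesis by blast
    qed
  qed
qed

definition level_set :: "(nat \<Rightarrow> nat \<Rightarrow> nat \<Rightarrow> bool) \<Rightarrow> nat \<Rightarrow> nat \<Rightarrow> nat \<Rightarrow> nat set" where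
  "level_set P j k t = {z. z < k \<and> P j z t}"

text \<open>\<open>r (j, b)\<close> is the representative of colour \<open>b\<close> already chosen
  for \<open>j\<close>. Injectivity keeps an element from getting two colours, and the last
  hypothesis makes a representative serve all large level sets at \<open>k\<close>. Each induction
  step fills the gaps, strips off the largest element and hands the surviving representatives
  down.\<close>

lemma precoloring_extension:
  fixes P :: "nat \<Rightarrow> nat \<Rightarrow> nat \<Rightarrow> bool" and r :: "nat \<times> bool \<rightharpoonup> nat"
  assumes anti: "\<And>j z t t'. t \<le> t' \<Longrightarrow> P j z t' \<Longrightarrow> P j z t"
    and r: "dom r \<subseteq> {..<n} \<times> UNIV" "inj_on r (dom r)" "ran r \<subseteq> {..<k}"
      "\<And>j b x t. r (j, b) = Some x \<Longrightarrow> t \<le> T \<Longrightarrow> card (level_set P j k t) \<ge> 2 * n \<Longrightarrow> x \<in> level_set P j k t"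
  shows "\<exists>f :: nat \<Rightarrow> bool. (\<forall>j b x. r (j, b) = Some x \<longrightarrow> f x = b) \<and>
    (\<forall>j<n. \<forall>k'\<le>k. \<forall>t\<le>T. card (level_set P j k' t) \<ge> 2 * n \<longrightarrow>
      (\<exists>x\<in>level_set P j k' t. \<exists>y\<in>level_set P j k' t. f x \<and> \<not> f y))"
  using r
proof (induction k arbitrary: r)
  case 0
  show ?case
  proof (intro exI conjI allI impI)
    show "(\<lambda>_. True) x = b" if "r (j, b) = Some x" for j b x
      using 0(3) that by (auto simp: ran_def)
    fix j k' t
    assume "j < n" "k' \<le> 0" "2 * n \<le> card (level_set P j k' t)"
    \<comment> \<open>The level set is empty, while \<open>j < n\<close> forces
      \<open>2 * n > 0\<close>, so the assumptions are contradictory.\<close>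
    then show "\<exists>x\<in>level_set P j k' t. \<exists>y\<in>level_set P j k' t. (\<lambda>_. True) x \<and> \<not> (\<lambda>_. True) y"
      by (simp add: level_set_def)
  qed
next
  case (Suc k)
  let ?L = "\<lambda>j t. level_set P j (Suc k) t"
  define big where "big j = {t. t \<le> T \<and> card (?L j t) \<ge> 2 * n}" for j
  define I where "I = {..<n} \<times> (UNIV :: bool set)"
  define J where "J = {i \<in> I. big (fst i) \<noteq> {}}"
  \<comment> \<open>For fixed \<open>j\<close> the level sets shrink as \<open>t\<close> grows, so
    the one for the largest \<open>t\<close> in \<open>big j\<close> lies in all the others, and a
    representative taken from it serves every such \<open>t\<close>.\<close>
  define W where "W i = ?L (fst i) (Max (big (fst i)))" for i :: "nat \<times> bool"
  have fin: "finite (big j)" for j unfolding big_def by simp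
  have W_sub: "W (j, b) \<subseteq> ?L j t" if "t \<in> big j" for j b t
    using Max_ge[OF fin that] anti unfolding W_def level_set_def by auto
  have "Max (big (fst i)) \<in> big (fst i)" if "i \<in> J" for i
    using that fin Max_in unfolding J_def by blast
  \<comment> \<open>\<open>card I = 2 * n\<close> explains the threshold: one slot for each
    \<open>j < n\<close> and each colour.\<close>
  then have W: "card I \<le> card (W i)" if "i \<in> J" for i
    using that unfolding W_def I_def big_def by (simp add: card_cartesian_product mult.commute)
  obtain r' where r': "r \<subseteq>\<^sub>m r'" "dom r' = dom r \<union> J" "inj_on r' (dom r')"
    "\<forall>i\<in>J - dom r. the (r' i) \<in> W i"
    using extend_representatives[of I J W r] W Suc.prems(1,2) unfolding I_def J_def by auto
  have r'_in: "x \<in> ?L j t" if "r' (j, b) = Some x" "t \<in> big j" "j < n" for j b x t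
  proof (cases "(j, b) \<in> dom r")
    case True
    then have "r (j, b) = Some x" using r'(1) that(1) by (auto simp: map_le_def)
    then show ?thesis using Suc.prems(4) that(2) unfolding big_def by blast
  next
    case False
    moreover have "(j, b) \<in> J" using that unfolding J_def I_def by auto
    ultimately show ?thesis using r'(4) that(1) W_sub[OF that(2)] by force
  qed
  have r'_dom: "dom r' \<subseteq> {..<n} \<times> UNIV" using r'(2) Suc.prems(1) unfolding J_def I_def by auto
  have r'_less: "x < Suc k" if "r' i = Some x" for i x
  proof (cases "i \<in> dom r")
    case True
    then have "r i = Some x" using r'(1) that by (auto simp: map_le_def)
    then show ?thesis using Suc.prems(3) ranI by fastforce
  next
    case False
    then have "i \<in> J" using r'(2) that by blast
    then show ?thesis using r'(4) False that unfolding W_def level_set_def by force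
  qed
  \<comment> \<open>Level sets at levels up to \<open>k\<close> do not contain \<open>k\<close>, so
    an index represented by \<open>k\<close> loses its representative; the colour of
    \<open>k\<close> is recorded in \<open>f'\<close>.\<close>
  define q where "q = (\<lambda>i. if r' i = Some k then None else r' i)"
  have q_r': "q i = Some x \<longleftrightarrow> r' i = Some x \<and> x \<noteq> k" for i x unfolding q_def by auto
  have "\<exists>f :: nat \<Rightarrow> bool. (\<forall>j b x. q (j, b) = Some x \<longrightarrow> f x = b) \<and>
    (\<forall>j<n. \<forall>k'\<le>k. \<forall>t\<le>T. card (level_set P j k' t) \<ge> 2 * n \<longrightarrow>
      (\<exists>x\<in>level_set P j k' t. \<exists>y\<in>level_set P j k' t. f x \<and> \<not> f y))"
  proof (rule Suc.IH)
    show "dom q \<subseteq> {..<n} \<times> UNIV" using r'_dom q_r' by blast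
    show "inj_on q (dom q)"
    proof (rule inj_onI)
      fix i i' assume "i \<in> dom q" "i' \<in> dom q" "q i = q i'"
      then obtain x where "q i = Some x" "q i' = Some x" by (metis domD)
      then have "r' i = Some x" "r' i' = Some x" using q_r' by auto
      then show "i = i'" using inj_onD[OF r'(3), of i i'] by (simp add: domI)
    qed
    show "ran q \<subseteq> {..<k}" using r'_less q_r' by (fastforce simp: ran_def less_Suc_eq)
    fix j b x t
    assume *: "q (j, b) = Some x" "t \<le> T" "2 * n \<le> card (level_set P j k t)"
    have "level_set P j k t \<subseteq> ?L j t" "finite (?L j t)" unfolding level_set_def by auto
    then have "card (level_set P j k t) \<le> card (?L j t)" by (rule card_mono[rotated])
    then have "t \<in> big j" using *(2,3) unfolding big_def by simp
    moreover have "j < n" "r' (j, b) = Some x" "x \<noteq> k" using *(1) q_r' r'_dom by auto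
    ultimately show "x \<in> level_set P j k t"
      using r'_in[of j b x t] unfolding level_set_def by auto
  qed
  then obtain f where f: "\<forall>j b x. q (j, b) = Some x \<longrightarrow> f x = b"
    "\<forall>j<n. \<forall>k'\<le>k. \<forall>t\<le>T. card (level_set P j k' t) \<ge> 2 * n \<longrightarrow>
      (\<exists>x\<in>level_set P j k' t. \<exists>y\<in>level_set P j k' t. f x \<and> \<not> f y)"
    by (elim exE conjE)
  \<comment> \<open>The colour of \<open>k\<close> is True if it represents True for some
    \<open>j\<close>, and False otherwise, also when it represents nothing. By injectivity of
    \<open>r'\<close> no demand for False is violated.\<close>
  define f' where "f' = f(k := \<exists>j. r' (j, True) = Some k)"
  have f'_r': "f' x = b" if "r' (j, b) = Some x" for j b x
  proof (cases "x = k")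
    case True
    have "b = b'" if "r' (j', b') = Some x" for j' b'
      using inj_onD[OF r'(3), of "(j, b)" "(j', b')"] \<open>r' (j, b) = Some x\<close> that by (simp add: domI)
    then show ?thesis using that True unfolding f'_def by (cases b) auto
  next
    case False
    then show ?thesis using f(1) that q_r' unfolding f'_def by simp
  qed
  have "f' x = b" if "r (j, b) = Some x" for j b x
  proof -
    have "r' (j, b) = Some x" using r'(1) that by (metis domI map_le_def)
    then show ?thesis by (rule f'_r')
  qed
  moreover have "\<exists>x\<in>level_set P j k' t. \<exists>y\<in>level_set P j k' t. f' x \<and> \<not> f' y"
    if *: "j < n" "k' \<le> Suc k" "t \<le> T" "card (level_set P j k' t) \<ge> 2 * n" for j k' t
  proof (cases "k' = Suc k")
    case True
    then have t: "t \<in> big j" using * unfolding big_def by blast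
    then have "(j, b) \<in> dom r'" for b using *(1) r'(2) unfolding J_def I_def by auto
    then obtain x y where xy: "r' (j, True) = Some x" "r' (j, False) = Some y" by blast
    then have "x \<in> ?L j t" "y \<in> ?L j t" "f' x" "\<not> f' y"
      using r'_in[OF _ t *(1)] f'_r'[OF xy(1)] f'_r'[OF xy(2)] by auto
    then show ?thesis unfolding True by blast
  next
    case False
    then have "k' \<le> k" using *(2) by simp
    then obtain x y where "x \<in> level_set P j k' t" "y \<in> level_set P j k' t" "f x" "\<not> f y"
      using f(2)[rule_format, OF *(1) _ *(3,4)] by blast
    moreover have "x \<noteq> k" "y \<noteq> k" using calculation \<open>k' \<le> k\<close> unfolding level_set_def by auto
    ultimately show ?thesis unfolding f'_def by auto
  qed
  ultimately show ?case by (intro exI[of _ f']) simp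
qed

lemma ex_separating_coloring:
  fixes P :: "nat \<Rightarrow> nat \<Rightarrow> nat \<Rightarrow> bool"
  assumes "\<And>j z t t'. t \<le> t' \<Longrightarrow> P j z t' \<Longrightarrow> P j z t"
  shows "\<exists>f. \<forall>j<n. \<forall>k\<le>s. \<forall>t\<le>T. card (level_set P j k t) \<ge> 2 * n \<longrightarrow>
      (\<exists>x\<in>level_set P j k t. \<exists>y\<in>level_set P j k t. f x \<and> \<not> f y)"
proof -
  have "\<exists>f. (\<forall>j b x. (Map.empty :: nat \<times> bool \<rightharpoonup> nat) (j, b) = Some x \<longrightarrow> f x = b) \<and>
    (\<forall>j<n. \<forall>k\<le>s. \<forall>t\<le>T. card (level_set P j k t) \<ge> 2 * n \<longrightarrow>
      (\<exists>x\<in>level_set P j k t. \<exists>y\<in>level_set P j k t. f x \<and> \<not> f y))"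
    by (rule precoloring_extension) (use assms in simp_all)
  then show ?thesis by (elim exE conjE) (rule exI)
qed

section \<open>The diagonal colouring\<close>

text \<open>Bit \<open>i\<close> is set when the quotient by \<open>2 ^ i\<close> is odd; division
  with remainder is spelled out by bounded quantifiers and arithmetic, for which closure rules are
  available.\<close>

lemma mem_set_decode_iff: "i \<in> set_decode H \<longleftrightarrow> (\<exists>q<Suc H. \<exists>r<2 ^ i. H = (2 * q + 1) * 2 ^ i + r)"
proof
  assume "i \<in> set_decode H"
  then obtain q where q: "H div 2 ^ i = 2 * q + 1" unfolding set_decode_def by (auto elim: oddE)
  have "H = (2 * q + 1) * 2 ^ i + H mod 2 ^ i" using div_mult_mod_eq[of H "2 ^ i"] q by simp
  moreover have "q \<le> H div 2 ^ i" using q by simp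
  then have "q < Suc H" using div_le_dividend[of H "2 ^ i"] by linarith
  ultimately show "\<exists>q<Suc H. \<exists>r<2 ^ i. H = (2 * q + 1) * 2 ^ i + r"
    by (intro exI[of _ q] conjI exI[of _ "H mod 2 ^ i"]) auto
next
  assume "\<exists>q<Suc H. \<exists>r<2 ^ i. H = (2 * q + 1) * 2 ^ i + r"
  then obtain q r where *: "r < 2 ^ i" "H = (2 * q + 1) * 2 ^ i + r" by blast
  then have "H div 2 ^ i = 2 * q + 1" by (simp add: div_add1_eq)
  then show "i \<in> set_decode H" unfolding set_decode_def by simp
qed

lemma decidable_mem_set_decode:
  assumes "computable F" "computable G"
  shows "decidable (\<lambda>e. G e \<in> set_decode (F e))"
proof -
  have *: "computable (\<lambda>e. F (\<lambda>i. e (Suc i)))" "computable (\<lambda>e. G (\<lambda>i. e (Suc i)))"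
    "computable (\<lambda>e. F (\<lambda>i. e (Suc (Suc i))))" "computable (\<lambda>e. G (\<lambda>i. e (Suc (Suc i))))"
    using computable_on_shift[OF assms(1)] computable_on_shift[OF assms(2)]
      computable_on_shift[of "\<lambda>_. True" "\<lambda>e. F (\<lambda>i. e (Suc i))"]
      computable_on_shift[of "\<lambda>_. True" "\<lambda>e. G (\<lambda>i. e (Suc i))"] by auto
  show ?thesis unfolding mem_set_decode_iff
    by (intro decidable_bex decidable_eq computable_on_Suc computable_on_add computable_on_mult
        computable_power2 computable_on_const computable_on_var assms *)
qed

lemma computable_prod_encode:
  assumes "computable F" "computable G"
  shows "computable (\<lambda>e. prod_encode (F e, G e))"
proof (rule computable_on_binary[OF _ assms])
  have "triangle n = (\<Sum>k<n. Suc k)" for n by (induction n) auto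
  moreover have "computable (\<lambda>e. (\<Sum>k<e 0 + e 1. Suc k) + e 0)"
    by (intro computable_on_add computable_sum computable_on_Suc computable_on_var)
  ultimately show "computable (\<lambda>e. prod_encode (e 0, e 1))" by (simp add: prod_encode_def)
qed

text \<open>Here \<open>n\<close> is a fixed number and \<open>P j\<close> may depend on
  \<open>j\<close> arbitrarily, as the machines \<open>M j\<close> do, so no uniformity in
  \<open>j\<close> is demanded.\<close>

lemma decidable_finite_ball:
  assumes "\<And>j. j < (n::nat) \<Longrightarrow> decidable (P j)"
  shows "decidable (\<lambda>e. \<forall>j<n. P j e)"
  using assms
proof (induction n)
  case 0
  then show ?case by (simp add: decidable_def computable_on_const)
next
  case (Suc n)
  then have "decidable (\<lambda>e. (\<forall>j<n. P j e) \<and> P n e)" by (intro decidable_and) auto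
  then show ?case unfolding decidable_def by (rule computable_on_cong) (auto simp: less_Suc_eq)
qed

text \<open>Coding the finite set of pairs of colour 1 as a number lets the stages of the
  construction be values of computable functions.\<close>

definition coloring_of :: "nat \<Rightarrow> coloring" where
  "coloring_of H a b \<longleftrightarrow> prod_encode (a, b) \<in> set_decode H"

lemma decidable_coloring_of:
  assumes "computable H" "computable A" "computable B"
  shows "decidable (\<lambda>e. coloring_of (H e) (A e) (B e))"
  unfolding coloring_of_def
  by (intro decidable_mem_set_decode computable_prod_encode assms)

lemma computable_oracle_of_coloring_of: "computable (\<lambda>e. oracle_of (coloring_of (e 0)) (e 1))"
proof -
  \<comment> \<open>Both components are bounded by the code \<open>q\<close>, so decoding is a
    bounded search. The disjunction sorts the pair and fails for \<open>a = b\<close>, where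
    \<open>oracle_of\<close> is 0.\<close>
  let ?Q = "\<lambda>H q. \<exists>a<Suc q. \<exists>b<Suc q. prod_encode (a, b) = q \<and>
    (a < b \<and> coloring_of H a b \<or> b < a \<and> coloring_of H b a)"
  have Q_iff: "?Q H q \<longleftrightarrow> oracle_of (coloring_of H) q = 1" for H q
  proof -
    obtain a b where ab: "prod_decode q = (a, b)" by (cases "prod_decode q")
    then have q: "q = prod_encode (a, b)" by (metis prod_decode_inverse)
    have "a < Suc q" "b < Suc q" unfolding q by (simp_all add: le_prod_encode_1 le_prod_encode_2 less_Suc_eq_le)
    then show ?thesis
      unfolding oracle_of_def ab color_def q by (auto simp: prod_encode_eq min_def max_def)
  qed
  have eq: "oracle_of (coloring_of H) q = of_bool (?Q H q)" for H q
    unfolding Q_iff by (simp add: oracle_of_def color_def split: prod.split)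
  have "decidable (\<lambda>e. ?Q (e 0) (e 1))"
    by (intro decidable_bex decidable_and decidable_or decidable_eq decidable_less decidable_coloring_of
        computable_prod_encode computable_on_Suc computable_on_var)
  then show ?thesis unfolding decidable_def eq .
qed

text \<open>A use of at most \<open>s\<close> suffices for querying only pairs below \<open>s\<close>, since
  \<open>a, b \<le> prod_encode (a, b)\<close>.\<close>

definition confirms :: "recf \<Rightarrow> nat \<Rightarrow> nat \<Rightarrow> nat \<Rightarrow> nat \<Rightarrow> nat \<Rightarrow> bool" where
  "confirms M s H z x y \<longleftrightarrow> (\<exists>u\<le>s. eval_use (oracle_of (coloring_of H)) M [z, x, y] 1 u)"

text \<open>Totality, applied to the oracles given by \<open>coloring_of\<close>, makes the
  simulation converge everywhere; as value and use are unique, the search for \<open>u\<close>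
  becomes a comparison of \<open>U\<close> with \<open>s\<close>.\<close>

lemma decidable_confirms:
  assumes total: "\<And>c z x y. \<exists>v. eval (oracle_of c) M [z, x, y] v"
    and "computable Fs" "computable Fh" "computable Fz" "computable Fx" "computable Fy"
  shows "decidable (\<lambda>e. confirms M (Fs e) (Fh e) (Fz e) (Fx e) (Fy e))"
proof -
  let ?\<omega> = "\<lambda>H. oracle_of (coloring_of H)"
  have three: "map e [0..<3] = [e 0, e 1, e 2]" for e :: "nat \<Rightarrow> nat"
    by (simp add: upt_rec numeral_eq_Suc)
  obtain V U where VU: "simulated ?\<omega> M 3 V U"
    using ex_simulated[of ?\<omega> M 3] computable_oracle_of_coloring_of by blast
  have "defined_at ?\<omega> M 3 e" for e
    unfolding defined_at_def three using total eval_imp_eval_use by blast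
  then have comp: "computable V" "computable U"
    using VU unfolding simulated_def by (auto intro: computable_on_cong)
  have iff: "confirms M s (e 3) (e 0) (e 1) (e 2) \<longleftrightarrow> V e = 1 \<and> U e \<le> s" for e s
  proof -
    obtain v u where vu: "eval_use (?\<omega> (e 3)) M [e 0, e 1, e 2] v u"
      using total eval_imp_eval_use by blast
    have VU': "V e = w" "U e = u'" if "eval_use (?\<omega> (e 3)) M [e 0, e 1, e 2] w u'" for w u'
      using VU that unfolding simulated_def three by blast+
    show ?thesis
    proof
      assume "confirms M s (e 3) (e 0) (e 1) (e 2)"
      then show "V e = 1 \<and> U e \<le> s" using VU' unfolding confirms_def by blast
    next
      assume "V e = 1 \<and> U e \<le> s"
      then have "v = 1" "u \<le> s" using VU'[OF vu] by auto
      then show "confirms M s (e 3) (e 0) (e 1) (e 2)" using vu unfolding confirms_def by blast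
    qed
  qed
  define G where "G i = (if i = 0 then Fz else if i = 1 then Fx else if i = 2 then Fy else Fh)" for i :: nat
  have G: "computable (G i)" for i by (simp add: G_def assms(3-6))
  have "computable (\<lambda>e. V (\<lambda>i. G i e))" "computable (\<lambda>e. U (\<lambda>i. G i e))"
    by (rule computable_on_subst[where G = G, OF comp(1) G TrueI] computable_on_subst[where G = G, OF comp(2) G TrueI])+
  then have "decidable (\<lambda>e. V (\<lambda>i. G i e) = 1 \<and> U (\<lambda>i. G i e) \<le> Fs e)"
    by (intro decidable_and decidable_eq decidable_le computable_on_const assms(2))
  moreover have "confirms M (Fs e) (Fh e) (Fz e) (Fx e) (Fy e) \<longleftrightarrow> V (\<lambda>i. G i e) = 1 \<and> U (\<lambda>i. G i e) \<le> Fs e" for e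
    using iff[of "Fs e" "\<lambda>i. G i e"] by (simp add: G_def)
  ultimately show ?thesis by simp
qed

definition promising :: "recf \<Rightarrow> nat \<Rightarrow> nat \<Rightarrow> nat \<Rightarrow> nat \<Rightarrow> bool" where
  "promising M s H z t \<longleftrightarrow> (\<forall>x<t. \<exists>y<s. confirms M s H z x y)"

text \<open>All quantifiers are bounded to fit the decidability rules. Treating only
  \<open>k, t \<le> s\<close> is enough, since any fixed \<open>k\<close> and \<open>t\<close> are
  covered from some stage on.\<close>

definition good_extension :: "nat \<Rightarrow> (nat \<Rightarrow> recf) \<Rightarrow> nat \<Rightarrow> nat \<Rightarrow> nat \<Rightarrow> bool" where
  "good_extension n M s H H' \<longleftrightarrow>
     (\<forall>a<s. \<forall>b<s. coloring_of H' a b \<longleftrightarrow> coloring_of H a b) \<and>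
     (\<forall>j<n. \<forall>k<Suc s. \<forall>t<Suc s. 2 * n \<le> card {z. z < k \<and> promising (M j) s H z t} \<longrightarrow>
       (\<exists>x<k. \<exists>y<k. (promising (M j) s H x t \<and> promising (M j) s H y t) \<and>
         coloring_of H' x s \<and> \<not> coloring_of H' y s))"

lemma decidable_promising:
  assumes "\<And>c z x y. \<exists>v. eval (oracle_of c) M [z, x, y] v"
  shows "decidable (\<lambda>e. promising M (e s) (e h) (e z) (e t))"
  unfolding promising_def
  by (intro decidable_ball decidable_bex decidable_confirms[OF assms] computable_on_var)

text \<open>The candidate \<open>H'\<close> is variable 0 because minimisation pushes its variable
  in front of the stage and the current code.\<close>

lemma decidable_good_extension:
  assumes total: "\<And>j c z x y. j < n \<Longrightarrow> \<exists>v. eval (oracle_of c) (M j) [z, x, y] v"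
  shows "decidable (\<lambda>e. good_extension n M (e 1) (e 2) (e 0))"
  unfolding good_extension_def
proof (intro decidable_and decidable_finite_ball)
  show "decidable (\<lambda>e. \<forall>a<e 1. \<forall>b<e 1. coloring_of (e 0) a b \<longleftrightarrow> coloring_of (e 2) a b)"
    by (intro decidable_ball decidable_iff decidable_coloring_of computable_on_var)
next
  fix j assume "j < n"
  note promising = decidable_promising[OF total[OF this]]
  show "decidable (\<lambda>e. \<forall>k<Suc (e 1). \<forall>t<Suc (e 1).
      2 * n \<le> card {z. z < k \<and> promising (M j) (e 1) (e 2) z t} \<longrightarrow>
      (\<exists>x<k. \<exists>y<k. (promising (M j) (e 1) (e 2) x t \<and> promising (M j) (e 1) (e 2) y t) \<and>
        coloring_of (e 0) x (e 1) \<and> \<not> coloring_of (e 0) y (e 1)))"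
    by (intro decidable_ball decidable_imp decidable_le decidable_bex decidable_and decidable_not
        decidable_coloring_of computable_card computable_on_Suc computable_on_const computable_on_var
        promising)
qed

lemma ex_good_extension: "\<exists>H'. good_extension n M s H H'"
proof -
  define P where "P j z t = promising (M j) s H z t" for j z t
  have anti: "P j z t" if "t \<le> t'" "P j z t'" for j z t t'
    using that unfolding P_def promising_def by auto
  have "\<exists>f. \<forall>j<n. \<forall>k\<le>s. \<forall>t\<le>s. card (level_set P j k t) \<ge> 2 * n \<longrightarrow>
      (\<exists>x\<in>level_set P j k t. \<exists>y\<in>level_set P j k t. f x \<and> \<not> f y)"
    by (rule ex_separating_coloring) (rule anti)
  then obtain f where f: "\<forall>j<n. \<forall>k\<le>s. \<forall>t\<le>s. card (level_set P j k t) \<ge> 2 * n \<longrightarrow>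
      (\<exists>x\<in>level_set P j k t. \<exists>y\<in>level_set P j k t. f x \<and> \<not> f y)"
    by (rule exE)
  \<comment> \<open>Old colours of pairs below \<open>s\<close> are kept, pairs of some
    \<open>x < s\<close> with \<open>s\<close> are coloured by \<open>f\<close>, and every other
    pair gets 0.\<close>
  define A where "A = prod_encode ` ({(a, b). a < s \<and> b < s \<and> coloring_of H a b} \<union> {(x, s) |x. x < s \<and> f x})"
  have "finite A" unfolding A_def
    by (rule finite_imageI, rule finite_subset[of _ "{..s} \<times> {..s}"]) auto
  then have "coloring_of (set_encode A) a b \<longleftrightarrow> prod_encode (a, b) \<in> A" for a b
    by (simp add: coloring_of_def set_encode_inverse)
  then have *: "coloring_of (set_encode A) a b \<longleftrightarrow>
      (a < s \<and> b < s \<and> coloring_of H a b) \<or> (a < s \<and> b = s \<and> f a)" for a b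
    by (auto simp: A_def prod_encode_eq)
  have "good_extension n M s H (set_encode A)"
    unfolding good_extension_def less_Suc_eq_le
  proof (intro conjI allI impI)
    fix j k t
    assume jkt: "j < n" "k \<le> s" "t \<le> s" "2 * n \<le> card {z. z < k \<and> promising (M j) s H z t}"
    then obtain x y where "x \<in> level_set P j k t" "y \<in> level_set P j k t" "f x" "\<not> f y"
      using f unfolding level_set_def P_def by blast
    then show "\<exists>x<k. \<exists>y<k. (promising (M j) s H x t \<and> promising (M j) s H y t) \<and>
         coloring_of (set_encode A) x s \<and> \<not> coloring_of (set_encode A) y s"
      using jkt(2) unfolding * level_set_def P_def by fastforce
  qed (simp add: *)
  then show ?thesis by blast
qed

section \<open>The construction by stages and its computability\<close>

definition history :: "nat \<Rightarrow> (nat \<Rightarrow> recf) \<Rightarrow> nat \<Rightarrow> nat" where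
  "history n M = rec_nat 0 (\<lambda>s H. LEAST H'. good_extension n M s H H')"

text \<open>Pairs with larger element \<open>b\<close> are coloured at stage \<open>b\<close>, whose
  result is the code for \<open>Suc b\<close>.\<close>

definition diagonal_coloring :: "nat \<Rightarrow> (nat \<Rightarrow> recf) \<Rightarrow> coloring" where
  "diagonal_coloring n M a b \<longleftrightarrow> coloring_of (history n M (Suc b)) a b"

lemma good_extension_history: "good_extension n M s (history n M s) (history n M (Suc s))"
  using LeastI_ex[OF ex_good_extension] by (simp add: history_def)

lemma history_agrees:
  assumes "a < b" "b < s"
  shows "coloring_of (history n M s) a b \<longleftrightarrow> diagonal_coloring n M a b"
  using assms(2)
proof (induction s)
  case (Suc s)
  show ?case
  proof (cases "b = s")
    case False
    then have "b < s" using Suc.prems by simp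
    then show ?thesis
      using Suc.IH good_extension_history[of n M s] assms(1) unfolding good_extension_def by simp
  qed (simp add: diagonal_coloring_def)
qed simp

text \<open>Both components of a pair are at most its code, so a pair with code below
  \<open>s\<close> already has its final colour.\<close>

lemma oracle_of_history:
  assumes "q < s"
  shows "oracle_of (coloring_of (history n M s)) q = oracle_of (diagonal_coloring n M) q"
proof -
  obtain a b where ab: "prod_decode q = (a, b)" by (cases "prod_decode q")
  then have "q = prod_encode (a, b)" by (metis prod_decode_inverse)
  then have "a < s" "b < s" using assms le_prod_encode_1[of a b] le_prod_encode_2[of b a] by simp_all
  then have "a \<noteq> b \<Longrightarrow> coloring_of (history n M s) (min a b) (max a b) \<longleftrightarrow> diagonal_coloring n M (min a b) (max a b)"
    by (intro history_agrees) auto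
  then show ?thesis by (simp add: oracle_of_def ab color_def)
qed

lemma computable_diagonal_coloring:
  assumes total: "\<And>j c z x y. j < n \<Longrightarrow> \<exists>v. eval (oracle_of c) (M j) [z, x, y] v"
  shows "computable_coloring (diagonal_coloring n M)"
proof -
  have "computable (\<lambda>e. LEAST H'. good_extension n M (e 0) (e 1) H')"
    using decidable_good_extension[of n M] total
    by (intro computable_Least ex_good_extension) (simp add: numeral_2_eq_2)
  then have "decidable (\<lambda>e. diagonal_coloring n M (e 0) (e 1))"
    unfolding diagonal_coloring_def history_def
    by (intro decidable_coloring_of computable_iterate computable_on_Suc computable_on_var)
  then obtain K where K: "\<And>k. k \<ge> K \<Longrightarrow> \<exists>f. \<forall>e. eval (\<lambda>_. 0) f (map e [0..<k])
      (of_bool (diagonal_coloring n M (e 0) (e 1)))"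
    unfolding decidable_def computable_on_def by auto
  obtain f where f: "\<And>e. eval (\<lambda>_. 0) f (map e [0..<Suc (Suc K)]) (of_bool (diagonal_coloring n M (e 0) (e 1)))"
    using K[of "Suc (Suc K)"] by (auto simp del: upt_Suc)
  \<comment> \<open>\<open>f\<close> expects \<open>Suc (Suc K)\<close> variables, but a colouring
    program gets only two arguments; the rest is padded with zeros.\<close>
  have "eval (\<lambda>_. 0) (Cn f (Id 0 # Id 1 # map (\<lambda>_. Z) [0..<K])) [a, b] (color (diagonal_coloring n M) a b)"
    if "a < b" for a b
  proof (rule eval_Cn)
    let ?e = "case_nat a (case_nat b (\<lambda>_. 0))"
    have "eval (\<lambda>_. 0) (Id 0) [a, b] a" "eval (\<lambda>_. 0) (Id 1) [a, b] b"
      using eval_Id[of 0 "[a, b]"] eval_Id[of 1 "[a, b]"] by simp_all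
    then show "list_all2 (\<lambda>g y. eval (\<lambda>_. 0) g [a, b] y) (Id 0 # Id 1 # map (\<lambda>_. Z) [0..<K]) (map ?e [0..<Suc (Suc K)])"
      unfolding map_case_nat_upt by (auto simp: list_all2_conv_all_nth nth_Cons eval_Z split: nat.split)
    show "eval (\<lambda>_. 0) f (map ?e [0..<Suc (Suc K)]) (color (diagonal_coloring n M) a b)"
    proof -
      have "color (diagonal_coloring n M) a b = of_bool (diagonal_coloring n M (?e 0) (?e 1))"
        using that by (simp add: color_def)
      then show ?thesis using f[of ?e] by (simp only:)
    qed
  qed
  then show ?thesis unfolding computable_coloring_def by blast
qed

section \<open>Promising numbers in the limit, and failure of homogeneity\<close>

lemma confirms_imp_eval:
  assumes "confirms M s (history n N s) z x y"
  shows "eval (oracle_of (diagonal_coloring n N)) M [z, x, y] 1"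
proof -
  obtain u where "u \<le> s" "eval_use (oracle_of (coloring_of (history n N s))) M [z, x, y] 1 u"
    using assms unfolding confirms_def by blast
  then have "eval_use (oracle_of (diagonal_coloring n N)) M [z, x, y] 1 u"
    using oracle_of_history[of _ s n N] by (elim eval_use_local) simp
  then show ?thesis by (rule eval_use_imp_eval)
qed

text \<open>Once the stage reaches the use, the history answers all queries as the final colouring
  does.\<close>

lemma eval_imp_eventually_confirms:
  assumes "eval (oracle_of (diagonal_coloring n N)) M [z, x, y] 1"
  shows "\<exists>s0. \<forall>s\<ge>s0. confirms M s (history n N s) z x y"
proof -
  obtain u where u: "eval_use (oracle_of (diagonal_coloring n N)) M [z, x, y] 1 u"
    using eval_imp_eval_use[OF assms] by blast
  have "confirms M s (history n N s) z x y" if "s \<ge> u" for s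
    unfolding confirms_def
    using eval_use_local[OF u, of "oracle_of (coloring_of (history n N s))"] oracle_of_history[of _ s n N] that
    by auto
  then show ?thesis by blast
qed

lemma eventually_promising:
  assumes "\<And>x. \<exists>y. eval (oracle_of (diagonal_coloring n N)) M [z, x, y] 1"
  shows "\<forall>\<^sub>F s in sequentially. promising M s (history n N s) z t"
proof -
  have "\<forall>\<^sub>F s in sequentially. \<exists>y<s. confirms M s (history n N s) z x y" for x
  proof -
    obtain y s0 where "\<forall>s\<ge>s0. confirms M s (history n N s) z x y"
      using assms eval_imp_eventually_confirms by blast
    \<comment> \<open>\<open>Suc y\<close> secures the condition \<open>y < s\<close> of
      \<open>promising\<close>.\<close>
    then show ?thesis
      unfolding eventually_sequentially by (intro exI[of _ "max s0 (Suc y)"]) (auto simp: Suc_le_eq)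
  qed
  then have "\<forall>\<^sub>F s in sequentially. \<forall>x\<in>{..<t}. \<exists>y<s. confirms M s (history n N s) z x y"
    by (intro eventually_ball_finite) auto
  then show ?thesis unfolding promising_def by (auto elim: eventually_mono)
qed

text \<open>Confirmations are true of the final colouring, so an \<open>x\<close> without witness is
  never confirmed; it is a bound that works for all stages.\<close>

lemma ex_not_promising:
  assumes "\<not> (\<forall>x. \<exists>y. eval (oracle_of (diagonal_coloring n N)) M [z, x, y] 1)"
  shows "\<exists>t0. \<forall>t>t0. \<forall>s. \<not> promising M s (history n N s) z t"
proof -
  obtain x where "\<And>y. \<not> eval (oracle_of (diagonal_coloring n N)) M [z, x, y] 1"
    using assms by blast
  then have "\<not> confirms M s (history n N s) z x y" for s y
    using confirms_imp_eval by blast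
  then have "\<not> promising M s (history n N s) z t" if "t > x" for s t
    unfolding promising_def using that by blast
  then show ?thesis by blast
qed

lemma diagonal_coloring_not_homogeneous:
  fixes M :: "nat \<Rightarrow> recf"
  assumes "j < n"
  defines "A \<equiv> {z. \<forall>x. \<exists>y. eval (oracle_of (diagonal_coloring n M)) (M j) [z, x, y] 1}"
  assumes inf: "infinite A"
  shows "\<not> homogeneous (diagonal_coloring n M) A"
proof
  let ?c = "diagonal_coloring n M"
  assume "homogeneous ?c A"
  then obtain col where col: "\<And>a b. a \<in> A \<Longrightarrow> b \<in> A \<Longrightarrow> a \<noteq> b \<Longrightarrow> color ?c a b = col"
    unfolding homogeneous_def by blast
  obtain F where F: "F \<subseteq> A" "finite F" "card F = 2 * n"
    using infinite_arbitrarily_large[OF inf, of "2 * n"] by auto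
  obtain k where k: "F \<subseteq> {..<k}" using F(2) unfolding finite_nat_iff_bounded by blast
  have "\<exists>t0. z \<notin> A \<longrightarrow> (\<forall>t>t0. \<forall>s. \<not> promising (M j) s (history n M s) z t)" for z
  proof (cases "z \<in> A")
    case False
    then show ?thesis using ex_not_promising[of n M "M j" z] unfolding A_def mem_Collect_eq by blast
  qed simp
  then obtain t0 where t0: "\<forall>z. z \<notin> A \<longrightarrow> (\<forall>t>t0 z. \<forall>s. \<not> promising (M j) s (history n M s) z t)"
    by metis
  \<comment> \<open>\<open>t\<close> exceeds the bounds of all nonmembers below \<open>k\<close>, so
    at late stages the numbers below \<open>k\<close> promising up to \<open>t\<close> are exactly
    the members of \<open>A\<close>.\<close>
  define t where "t = Suc (\<Sum>z<k. t0 z)"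
  have t: "t > t0 z" if "z < k" for z
    using that member_le_sum[of z "{..<k}" t0] unfolding t_def by simp
  have "\<forall>\<^sub>F s in sequentially. \<forall>z\<in>A \<inter> {..<k}. promising (M j) s (history n M s) z t"
    unfolding A_def by (intro eventually_ball_finite ballI eventually_promising) auto
  then obtain s0 where s0: "\<And>s z. s \<ge> s0 \<Longrightarrow> z \<in> A \<Longrightarrow> z < k \<Longrightarrow> promising (M j) s (history n M s) z t"
    unfolding eventually_sequentially by auto
  \<comment> \<open>\<open>k, t \<le> s\<close> puts this level set among those treated at stage
    \<open>s\<close>, and makes the witnesses below \<open>k\<close> smaller than \<open>s\<close>;
    \<open>s \<in> A\<close> brings their pairs with \<open>s\<close> under homogeneity.\<close>
  obtain s where s: "s \<in> A" "s \<ge> s0" "s \<ge> k" "s \<ge> t"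
    using inf infinite_nat_iff_unbounded_le[of A] by (meson max.bounded_iff)
  have promising_iff: "promising (M j) s (history n M s) z t \<longleftrightarrow> z \<in> A" if "z < k" for z
    using s0[OF s(2)] t0 t that by blast
  have "F \<subseteq> {z. z < k \<and> promising (M j) s (history n M s) z t}"
    using F(1) k promising_iff by auto
  then have "2 * n \<le> card {z. z < k \<and> promising (M j) s (history n M s) z t}"
    using card_mono[of "{z. z < k \<and> promising (M j) s (history n M s) z t}" F] F(3) by simp
  then obtain x y where xy: "x < k" "y < k"
      "promising (M j) s (history n M s) x t" "promising (M j) s (history n M s) y t"
      "coloring_of (history n M (Suc s)) x s" "\<not> coloring_of (history n M (Suc s)) y s"
    using good_extension_history[of n M s] assms(1) s(3,4)
    unfolding good_extension_def less_Suc_eq_le by blast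
  then have "x \<in> A" "y \<in> A" using promising_iff by auto
  then have "color ?c x s = col" "color ?c y s = col" using col s xy(1,2) by auto
  moreover have "color ?c x s = 1" "color ?c y s = 0"
    using xy s(3) by (auto simp: color_def diagonal_coloring_def min_def max_def)
  ultimately show False by simp
qed

theorem mainTheorem2:
  fixes n :: nat
    and R :: "nat \<Rightarrow> nat \<Rightarrow> nat \<Rightarrow> nat \<Rightarrow> coloring \<Rightarrow> bool"
  assumes "n \<ge> 1"
    and "\<forall>j<n. total_oracle_computable (R j)"
  shows "\<exists>c. computable_coloring c \<and>
           (\<forall>j<n. \<not> (infinite {z. \<forall>x. \<exists>y. R j z x y c} \<and>
                       homogeneous c {z. \<forall>x. \<exists>y. R j z x y c}))"
proof -
  obtain M where total: "\<And>j c z x y. j < n \<Longrightarrow> \<exists>v. eval (oracle_of c) (M j) [z, x, y] v"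
    and M: "\<And>j c z x y. j < n \<Longrightarrow> R j z x y c \<longleftrightarrow> eval (oracle_of c) (M j) [z, x, y] 1"
    using assms(2) unfolding total_oracle_computable_def by metis
  show ?thesis
  proof (intro exI[of _ "diagonal_coloring n M"] conjI allI impI notI; (elim conjE)?)
    show "computable_coloring (diagonal_coloring n M)"
      using total by (rule computable_diagonal_coloring)
    fix j assume j: "j < n"
    assume "infinite {z. \<forall>x. \<exists>y. R j z x y (diagonal_coloring n M)}"
      and "homogeneous (diagonal_coloring n M) {z. \<forall>x. \<exists>y. R j z x y (diagonal_coloring n M)}"
    then show False
      unfolding M[OF j] by (rule diagonal_coloring_not_homogeneous[OF j, THEN notE])
  qed
qed

end
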